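(* For non-negative integers $n,m$, $$P_{x_{12}^nx_{23}^m}(\beta)=\sum_{k=0}^{\min(n,m)}\binom{n+m-k}{m}\binom mk\beta^k=\sum_{k=0}^{\min(n,m)}\binom nk\binom mk(1+\beta)^k.$$ Moreover: - the polynomial $P_{(x_{12}x_{23}\cdots x_{n-1,n})^m}(\beta-1)$ is a symmetric polynomial in $\beta$ with non-negative coefficients; - the polynomial $P_{x_{12}^nx_{23}^m}(\beta)$ counts the number of $(n,m)$-Delannoy paths according to the number of $NE$ steps, i.e. the coefficient of $\beta^k$ is the number of $(n,m)$-Delannoy paths with exactly $k$ $NE$ steps.
   Context: For a monomial $M$ in commuting variables $x_{ij}$, $i<j$, over $\mathbb{Z}[\beta]$, a reduced polynomial of $M$ is obtained by repeatedly replacing (in any monomial) a product $x_{ij}x_{jk}$, $i<j<k$, by $x_{ik}x_{ij}+x_{jk}x_{ik}+\beta x_{ik}$, until no monomial contains such a product. $P_M(\beta)$ denotes the value of the reduced polynomial at $x_{ij}=1$ for all $i<j$ (the replacements are applied successively starting from the leftmost variables $x_{12}^{m_1}x_{23}$). An $(n,m)$-Delannoy path is a lattice path from $(0,0)$ to $(n,m)$ with steps $E=(1,0)$, $N=(0,1)$, $NE=(1,1)$. A polynomial $\sum_{i=0}^{d}a_i\beta^i$ of degree $d$ is symmetric if $a_i=a_{d-i}$. *)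

theory Defs
  imports Complex_Main "HOL-Library.Poly_Mapping" "HOL-Computational_Algebra.Polynomial"
begin

text \<open>
  Polynomials in the commuting variables \<open>x\<^sub>i\<^sub>j\<close> over \<open>\<int>[\<beta>]\<close>: the ring \<open>\<int>[\<beta>]\<close> is \<open>int poly\<close>, and a
  monomial is the finitely supported function sending \<open>(i, j)\<close> to the exponent of \<open>x\<^sub>i\<^sub>j\<close> (so that
  products of monomials are sums of exponent functions). Only variables with \<open>i < j\<close> are ever used.
\<close>

type_synonym xmonom = "(nat \<times> nat) \<Rightarrow>\<^sub>0 nat"
type_synonym xpoly = "xmonom \<Rightarrow>\<^sub>0 int poly"

definition beta :: "int poly" where
  "beta = [:0, 1:]"

definition xmon :: "nat \<Rightarrow> nat \<Rightarrow> xmonom" where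
  "xmon i j = Poly_Mapping.single (i, j) 1"

definition xconst :: "int poly \<Rightarrow> xpoly" where
  "xconst c = Poly_Mapping.single 0 c"

definition X :: "nat \<Rightarrow> nat \<Rightarrow> xpoly" where
  "X i j = Poly_Mapping.single (xmon i j) 1"

definition xeval :: "(nat \<times> nat \<Rightarrow> int poly) \<Rightarrow> xpoly \<Rightarrow> int poly" where
  "xeval f Q = (\<Sum>M\<in>Poly_Mapping.keys Q. Poly_Mapping.lookup Q M *
     (\<Prod>v\<in>Poly_Mapping.keys M. f v ^ Poly_Mapping.lookup M v))"

definition replaceable :: "xmonom \<Rightarrow> nat \<Rightarrow> nat \<Rightarrow> nat \<Rightarrow> bool" where
  "replaceable M i j k \<longleftrightarrow> i < j \<and> j < k \<and>
     Poly_Mapping.lookup M (i, j) > 0 \<and> Poly_Mapping.lookup M (j, k) > 0"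

text \<open>
  Replacements start from the left: a product \<open>x\<^sub>i\<^sub>j x\<^sub>j\<^sub>k\<close> is replaced in a monomial only when no other
  replaceable product of that monomial lies to its left, positions being compared
  componentwise. In \<open>x\<^sub>1\<^sub>2\<^sup>a x\<^sub>2\<^sub>3\<^sup>b x\<^sub>3\<^sub>4\<^sup>c \<cdots>\<close> (\<open>a, b > 0\<close>) the only such product is \<open>x\<^sub>1\<^sub>2 x\<^sub>2\<^sub>3\<close>.
  Products that are incomparable, such as \<open>x\<^sub>1\<^sub>4 x\<^sub>4\<^sub>5\<close> and \<open>x\<^sub>2\<^sub>3 x\<^sub>3\<^sub>4\<close>, may be replaced in either order.
\<close>

definition leftmost_replaceable :: "xmonom \<Rightarrow> nat \<Rightarrow> nat \<Rightarrow> nat \<Rightarrow> bool" where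
  "leftmost_replaceable M i j k \<longleftrightarrow> replaceable M i j k \<and>
     (\<forall>i' j' k'. replaceable M i' j' k' \<and> i' \<le> i \<and> j' \<le> j \<and> k' \<le> k \<longrightarrow>
        i' = i \<and> j' = j \<and> k' = k)"

text \<open>
  One replacement: the term \<open>c R x\<^sub>i\<^sub>j x\<^sub>j\<^sub>k\<close> of a polynomial, with \<open>c\<close> its full (nonzero) coefficient
  and \<open>R\<close> the rest of the monomial, is rewritten; \<open>r\<close> collects the other terms.
\<close>

inductive reduction_step :: "xpoly \<Rightarrow> xpoly \<Rightarrow> bool" where
  "leftmost_replaceable M i j k \<Longrightarrow> M = R + xmon i j + xmon j k \<Longrightarrow>
   c \<noteq> 0 \<Longrightarrow> M \<notin> Poly_Mapping.keys r \<Longrightarrow>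
   reduction_step
     (Poly_Mapping.single M c + r)
     (Poly_Mapping.single R c * (X i k * X i j + X j k * X i k + xconst beta * X i k) + r)"

definition reduced_poly_of :: "xpoly \<Rightarrow> xpoly \<Rightarrow> bool" where
  "reduced_poly_of M Q \<longleftrightarrow> reduction_step\<^sup>*\<^sup>* M Q \<and>
     (\<forall>T\<in>Poly_Mapping.keys Q. \<nexists>i j k. replaceable T i j k)"

text \<open>
  \<open>reduced_value M\<close> is the polynomial \<open>P\<^sub>M(\<beta>)\<close>. The reduced polynomial itself may depend on the choices
  left open above; its value at \<open>x\<^sub>i\<^sub>j = 1\<close> does not.
\<close>

definition reduced_value :: "xpoly \<Rightarrow> int poly" where
  "reduced_value M = (THE p. \<exists>Q. reduced_poly_of M Q \<and> p = xeval (\<lambda>_. 1) Q)"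

definition symmetric_poly :: "int poly \<Rightarrow> bool" where
  "symmetric_poly p \<longleftrightarrow> (\<forall>i\<le>degree p. coeff p i = coeff p (degree p - i))"

datatype lattice_step = East | North | NorthEast

fun walk :: "nat \<times> nat \<Rightarrow> lattice_step list \<Rightarrow> nat \<times> nat" where
  "walk p [] = p"
| "walk (a, b) (East # w) = walk (a + 1, b) w"
| "walk (a, b) (North # w) = walk (a, b + 1) w"
| "walk (a, b) (NorthEast # w) = walk (a + 1, b + 1) w"

definition delannoy_paths :: "nat \<Rightarrow> nat \<Rightarrow> lattice_step list set" where
  "delannoy_paths n m = {w. walk (0, 0) w = (n, m)}"

end

theory Submission
  imports Defs "HOL-Computational_Algebra.Polynomial_FPS" "HOL-Combinatorics.Permutations"
begin

text \<open>
  With \<open>t = 1 + \<beta>\<close>, the value \<open>P\<^sub>M(t - 1)\<close> equals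
  \<open>h\<^sub>M(t) = (1 - t)\<^bsup>deg M\<^esup> \<Sum>\<^sub>f t\<^bsup>N(f)\<^esup>\<close>, where \<open>f\<close> runs over the non-negative integer flows on the multigraph
  of \<open>M\<close> and \<open>N(f)\<close> is the sum of the positive parts of the divergences of \<open>f\<close>. Rerouting the common flow of
  two consecutive edges shows that \<open>h\<close> satisfies the replacement relation, and \<open>h\<^sub>M = 1\<close> when no replacement
  is possible, since then \<open>N(f)\<close> is the total flow. Hence the value does not depend on the choices made.

  Allowing edges that must carry positive flow turns the relation into
  \<open>h(x\<^sub>i\<^sub>j x\<^sub>j\<^sub>k) = h(x\<^sub>i\<^sub>k x\<^sub>i\<^sub>j) + h(x\<^sub>i\<^sub>k x'\<^sub>j\<^sub>k)\<close> and its analogues, without signs, which gives non-negative coefficients.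
  The relations are stable under exchanging the two kinds of edges, and this exchange acts on \<open>h\<close> as
  \<open>h(t) \<mapsto> t\<^bsup>deg\<^esup> h(1/t)\<close>. For powers of the path monomial, adding one unit to every edge multiplies the series by
  \<open>t\<^sup>m\<close>; together these give the symmetry. For \<open>x\<^sub>1\<^sub>2\<^sup>n x\<^sub>2\<^sub>3\<^sup>m\<close> the relation is the recurrence of Delannoy paths.
\<close>

section \<open>Flows on multigraphs\<close>

text \<open>
  An edge \<open>((i, j), l)\<close> carries flow from \<open>i\<close> to \<open>j\<close> bounded below by \<open>l\<close>; only \<open>l = 0\<close> (a variable
  \<open>x\<^sub>i\<^sub>j\<close>) and \<open>l = 1\<close> (the element \<open>x\<^sub>i\<^sub>j + \<beta>\<close>) matter. Vertices are the numbers below \<open>K\<close>.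
\<close>

type_synonym edge = "nat \<times> nat"
type_synonym hedge = "edge \<times> nat"

definition divergence :: "(hedge \<times> nat) list \<Rightarrow> nat \<Rightarrow> int" where
  "divergence ps v = (\<Sum>(((i, j), l), c)\<leftarrow>ps. int c * (of_bool (i = v) - of_bool (j = v)))"

text \<open>A vertex with positive divergence acts as a source, so this is the total amount of flow
  supplied from outside.\<close>

definition inflow :: "nat \<Rightarrow> (hedge \<times> nat) list \<Rightarrow> nat" where
  "inflow K ps = (\<Sum>v<K. nat (divergence ps v))"

text \<open>A list keeps parallel edges apart by position, so that each copy of an edge carries a
  value of its own.\<close>

definition flows :: "hedge list \<Rightarrow> (hedge \<times> nat) list set" where
  "flows es = {ps. map fst ps = es \<and> (\<forall>((e, l), c)\<in>set ps. l \<le> c)}"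

definition flows_of_inflow :: "nat \<Rightarrow> hedge list \<Rightarrow> nat \<Rightarrow> (hedge \<times> nat) list set" where
  "flows_of_inflow K es k = {ps \<in> flows es. inflow K ps = k}"

text \<open>Since \<open>card\<close> is 0 on infinite sets, the counts are meaningful through
  \<open>finite_flows_of_inflow\<close>: increasing edges exclude circulations, which could be
  enlarged without changing the inflow.\<close>

definition flow_gf :: "nat \<Rightarrow> hedge list \<Rightarrow> int fps" where
  "flow_gf K es = Abs_fps (\<lambda>k. int (card (flows_of_inflow K es k)))"

definition acyclic_edges :: "nat \<Rightarrow> hedge list \<Rightarrow> bool" where
  "acyclic_edges K es \<longleftrightarrow> (\<forall>((i, j), l)\<in>set es. i < j \<and> j < K)"

lemma divergence_Nil [simp]: "divergence [] v = 0"
  by (simp add: divergence_def)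

lemma divergence_Cons [simp]:
  "divergence ((((i, j), l), c) # ps) v = int c * (of_bool (i = v) - of_bool (j = v)) + divergence ps v"
  by (simp add: divergence_def)

lemma acyclic_edges_Nil [simp]: "acyclic_edges K []"
  by (simp add: acyclic_edges_def)

lemma acyclic_edges_Cons [simp]:
  "acyclic_edges K (((i, j), l) # es) \<longleftrightarrow> i < j \<and> j < K \<and> acyclic_edges K es"
  by (auto simp: acyclic_edges_def)

lemma flows_Nil [simp]: "flows [] = {[]}"
  by (auto simp: flows_def)

lemma flows_Cons: "flows (e # es) = (\<lambda>(c, ps). (e, c) # ps) ` ({snd e..} \<times> flows es)"
proof (rule set_eqI)
  fix ps show "ps \<in> flows (e # es) \<longleftrightarrow> ps \<in> (\<lambda>(c, ps). (e, c) # ps) ` ({snd e..} \<times> flows es)"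
    by (cases ps) (auto simp: flows_def image_iff)
qed

text \<open>An edge with both ends on the same side of the cut after \<open>u\<close> cancels, which
  leaves the net flow across that cut.\<close>

lemma sum_divergence_atMost:
  "(\<Sum>v\<le>u. divergence ps v) = (\<Sum>(((i, j), l), c)\<leftarrow>ps. int c * (of_bool (i \<le> u) - of_bool (j \<le> u)))"
proof (induction ps)
  case (Cons p ps)
  obtain i j l c where p: "p = (((i, j), l), c)" by (cases p) auto
  have *: "(\<Sum>v\<le>u. of_bool (w = v)) = (of_bool (w \<le> u) :: int)" for w
    by (simp add: of_bool_def)
  have "(\<Sum>v\<le>u. int c * (of_bool (i = v) - of_bool (j = v))) = int c * (of_bool (i \<le> u) - of_bool (j \<le> u))"
    by (simp only: * sum_subtractf flip: sum_distrib_left)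
  then show ?case
    by (simp add: p Cons.IH sum.distrib)
qed simp

text \<open>Every unit of flow on an edge leaving \<open>i\<close> crosses the cut between \<open>{..i}\<close> and its complement.\<close>

lemma flow_le_inflow:
  assumes "acyclic_edges K es" "ps \<in> flows es" "(e, c) \<in> set ps"
  shows "c \<le> inflow K ps"
proof -
  obtain i j l where e: "e = ((i, j), l)" by (cases e) auto
  have ac: "i' < j' \<and> j' < K" if "(((i', j'), l'), c') \<in> set ps" for i' j' l' c'
    using that assms(1,2) unfolding acyclic_edges_def flows_def by force
  let ?f = "\<lambda>(((i', j'), l'), c'). int c' * (of_bool (i' \<le> i) - of_bool (j' \<le> i))"
  have "int c = ?f (e, c)" using ac[of i j l c] assms(3) by (simp add: e)
  also have "\<dots> \<le> (\<Sum>p\<leftarrow>ps. ?f p)"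
  proof (rule member_le_sum_list)
    fix x assume "x \<in> set (map ?f ps)"
    then obtain i' j' l' c' where "(((i', j'), l'), c') \<in> set ps" and x: "x = ?f (((i', j'), l'), c')" by auto
    then show "0 \<le> x" using ac[of i' j' l' c'] by (auto simp: of_bool_def)
  qed (use assms(3) in force)
  also have "\<dots> = (\<Sum>v\<le>i. divergence ps v)" by (simp add: sum_divergence_atMost)
  also have "\<dots> \<le> (\<Sum>v\<le>i. int (nat (divergence ps v)))" by (intro sum_mono) auto
  also have "\<dots> \<le> (\<Sum>v<K. int (nat (divergence ps v)))"
    using ac[of i j l c] assms(3) by (intro sum_mono2) (auto simp: e)
  also have "\<dots> = int (inflow K ps)" by (simp only: inflow_def of_nat_sum)
  finally show ?thesis by simp
qed

lemma finite_flows_of_inflow: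
  assumes "acyclic_edges K es"
  shows "finite (flows_of_inflow K es k)"
proof (rule finite_subset)
  show "flows_of_inflow K es k \<subseteq> {ps. set ps \<subseteq> set es \<times> {..k} \<and> length ps = length es}"
  proof
    fix ps assume ps: "ps \<in> flows_of_inflow K es k"
    then have "map fst ps = es" by (simp add: flows_of_inflow_def flows_def)
    moreover from this have "fst p \<in> set es" if "p \<in> set ps" for p using that by auto
    moreover have "snd p \<le> k" if "p \<in> set ps" for p
      using flow_le_inflow[OF assms, of ps "fst p" "snd p"] that ps by (simp add: flows_of_inflow_def)
    ultimately show "ps \<in> {ps. set ps \<subseteq> set es \<times> {..k} \<and> length ps = length es}"
      by (auto simp: mem_Times_iff)
  qed
  show "finite {ps. set ps \<subseteq> set es \<times> {..k} \<and> length ps = length es}"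
    by (intro finite_lists_length_eq) auto
qed

section \<open>Independence of the order of the edges\<close>

lemma divergence_mset_cong:
  assumes "mset ps = mset qs"
  shows "divergence ps = divergence qs"
proof -
  have "sum_list (map f ps) = sum_mset (image_mset f (mset ps))" for f :: "hedge \<times> nat \<Rightarrow> int" and ps
    by (simp flip: sum_mset_sum_list)
  then show ?thesis using assms by (simp add: divergence_def fun_eq_iff)
qed

lemma inflow_mset_cong: "mset ps = mset qs \<Longrightarrow> inflow K ps = inflow K qs"
  unfolding inflow_def using divergence_mset_cong[of ps qs] by simp

text \<open>Permuting a flow along with its edges is a bijection that keeps the inflow. This allows
  any two edges to be moved to the front of the list.\<close>

lemma flow_gf_mset_cong:
  assumes "mset es = mset es'"
  shows "flow_gf K es = flow_gf K es'"
proof -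
  obtain p where p: "p permutes {..<length es'}" and es: "permute_list p es' = es"
    using mset_eq_permutation[OF assms] .
  have len: "length es = length es'" using es by auto
  have p': "inv p permutes {..<length es'}" using p by (rule permutes_inv)
  have es': "permute_list (inv p) es = es'"
    using permute_list_compose[OF p', of p] p by (simp add: es permutes_inv_o)
  have perm: "permute_list q ps \<in> flows_of_inflow K (permute_list q xs) k"
    if "q permutes {..<length xs}" "ps \<in> flows_of_inflow K xs k" for q ps xs k
  proof -
    from that have q: "q permutes {..<length ps}" and ps: "map fst ps = xs"
      by (auto simp: flows_of_inflow_def flows_def)
    have "mset (permute_list q ps) = mset ps" using q by simp
    then have "inflow K (permute_list q ps) = inflow K ps" by (rule inflow_mset_cong)
    moreover have "set (permute_list q ps) = set ps" using q by simp
    ultimately show ?thesis using that ps permute_list_map[OF q, of fst]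
      by (simp add: flows_of_inflow_def flows_def)
  qed
  have "bij_betw (permute_list p) (flows_of_inflow K es' k) (flows_of_inflow K es k)" for k
  proof (rule bij_betw_byWitness[where f' = "permute_list (inv p)"])
    show "permute_list p ` flows_of_inflow K es' k \<subseteq> flows_of_inflow K es k"
      using perm[OF p] es by auto
    show "permute_list (inv p) ` flows_of_inflow K es k \<subseteq> flows_of_inflow K es' k"
      using perm[of "inv p" es] p' es' len by auto
    show "\<forall>ps\<in>flows_of_inflow K es' k. permute_list (inv p) (permute_list p ps) = ps"
    proof
      fix ps assume "ps \<in> flows_of_inflow K es' k"
      then have "length ps = length es'" by (auto simp: flows_of_inflow_def flows_def)
      then show "permute_list (inv p) (permute_list p ps) = ps"
        using permute_list_compose[of "inv p" ps p] p p' by (simp add: permutes_inv_o)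
    qed
    show "\<forall>ps\<in>flows_of_inflow K es k. permute_list p (permute_list (inv p) ps) = ps"
    proof
      fix ps assume "ps \<in> flows_of_inflow K es k"
      then have "length ps = length es'" using len by (auto simp: flows_of_inflow_def flows_def)
      then show "permute_list p (permute_list (inv p) ps) = ps"
        using permute_list_compose[of p ps "inv p"] p p' by (simp add: permutes_inv_o)
    qed
  qed
  then show ?thesis unfolding flow_gf_def by (metis bij_betw_same_card)
qed

lemma inflow_cong: "divergence ps = divergence qs \<Longrightarrow> inflow K ps = inflow K qs"
  by (simp add: inflow_def)

section \<open>Relations between flow series\<close>

lemma divergence_relabel: "divergence (((e, l), c) # ps) = divergence (((e, 0), c) # ps)"
  by (cases e) (simp add: fun_eq_iff)

text \<open>Bounds do not affect the inflow. Writing the first edge with bound 0 inside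
  \<open>inflow\<close> makes the sets for different \<open>l\<close> directly comparable.\<close>

lemma bij_betw_flows_Cons:
  "bij_betw (\<lambda>(c, ps). ((e, l), c) # ps)
     {(c, ps). l \<le> c \<and> ps \<in> flows es \<and> inflow K (((e, 0), c) # ps) = k}
     (flows_of_inflow K ((e, l) # es) k)"
  unfolding bij_betw_def
proof
  have "inflow K (((e, l), c) # ps) = inflow K (((e, 0), c) # ps)" for c ps
    by (rule inflow_cong[OF divergence_relabel])
  then show "(\<lambda>(c, ps). ((e, l), c) # ps) ` {(c, ps). l \<le> c \<and> ps \<in> flows es \<and> inflow K (((e, 0), c) # ps) = k}
    = flows_of_inflow K ((e, l) # es) k"
    by (force simp: flows_of_inflow_def flows_Cons image_iff)
qed (auto simp: inj_on_def)

lemma bij_betw_flows_Cons2: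
  "bij_betw (\<lambda>(a, b, ps). ((e, l), a) # ((e', l'), b) # ps)
     {(a, b, ps). l \<le> a \<and> l' \<le> b \<and> ps \<in> flows es \<and> inflow K (((e, 0), a) # ((e', 0), b) # ps) = k}
     (flows_of_inflow K ((e, l) # (e', l') # es) k)"
  unfolding bij_betw_def
proof
  have "divergence (((e, l), a) # ((e', l'), b) # ps) = divergence (((e, 0), a) # ((e', 0), b) # ps)" for a b ps
    by (cases e; cases e') (simp add: fun_eq_iff)
  then have "inflow K (((e, l), a) # ((e', l'), b) # ps) = inflow K (((e, 0), a) # ((e', 0), b) # ps)" for a b ps
    by (rule inflow_cong)
  then show "(\<lambda>(a, b, ps). ((e, l), a) # ((e', l'), b) # ps) `
      {(a, b, ps). l \<le> a \<and> l' \<le> b \<and> ps \<in> flows es \<and> inflow K (((e, 0), a) # ((e', 0), b) # ps) = k}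
    = flows_of_inflow K ((e, l) # (e', l') # es) k"
    by (force simp: flows_of_inflow_def flows_Cons image_iff)
qed (auto simp: inj_on_def)

text \<open>A flow that vanishes on the first edge is a flow on the others; any other flow meets the
  bound 1.\<close>

lemma flow_gf_split_bound:
  assumes "acyclic_edges K ((e, 0) # es)"
  shows "flow_gf K ((e, 0) # es) = flow_gf K ((e, 1) # es) + flow_gf K es"
proof -
  obtain i j where e: "e = (i, j)" by (cases e)
  have "card (flows_of_inflow K ((e, 0) # es) k) =
      card (flows_of_inflow K ((e, 1) # es) k) + card (flows_of_inflow K es k)" for k
  proof -
    let ?T = "\<lambda>l. {(c, ps). l \<le> c \<and> ps \<in> flows es \<and> inflow K (((e, 0), c) # ps) = k}"
    have inf: "inflow K (((e, 0), 0) # ps) = inflow K ps" for ps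
      by (rule inflow_cong) (simp add: e fun_eq_iff)
    have T: "?T 0 = ?T 1 \<union> Pair 0 ` flows_of_inflow K es k"
    proof (rule set_eqI)
      fix x :: "nat \<times> (hedge \<times> nat) list"
      obtain c ps where "x = (c, ps)" by (cases x)
      then show "x \<in> ?T 0 \<longleftrightarrow> x \<in> ?T 1 \<union> Pair 0 ` flows_of_inflow K es k"
        by (cases "c = 0") (simp_all add: flows_of_inflow_def image_iff inf)
    qed
    have "finite (?T 1)" "finite (Pair 0 ` flows_of_inflow K es k)"
      using bij_betw_finite[OF bij_betw_flows_Cons[of e 1 es K k]] assms
      by (auto simp: finite_flows_of_inflow e)
    then have "card (?T 0) = card (?T 1) + card (Pair (0::nat) ` flows_of_inflow K es k)"
      unfolding T by (rule card_Un_disjoint) auto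
    then show ?thesis
      using bij_betw_same_card[OF bij_betw_flows_Cons[of e 0 es K k]]
        bij_betw_same_card[OF bij_betw_flows_Cons[of e 1 es K k]]
      by (simp add: card_image inj_on_def)
  qed
  then show ?thesis by (simp add: flow_gf_def fps_eq_iff)
qed

text \<open>
  The flow common to the two edges \<open>i \<rightarrow> j \<rightarrow> k\<close> is rerouted through \<open>i \<rightarrow> k\<close>. The offset \<open>s\<close>
  decides which side receives the flows with equal values on both edges.
\<close>

lemma flow_gf_exchange:
  assumes "i < j" "j < k" "k < K" "acyclic_edges K es"
    and s: "s \<le> 1" "p \<le> q + s" "q + s \<le> p + 1"
  shows "flow_gf K (((i, j), p) # ((j, k), q) # es) =
         flow_gf K (((i, k), q) # ((i, j), s) # es) + flow_gf K (((i, k), p) # ((j, k), 1 - s) # es)"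
proof -
  have "card (flows_of_inflow K (((i, j), p) # ((j, k), q) # es) n) =
      card (flows_of_inflow K (((i, k), q) # ((i, j), s) # es) n) +
      card (flows_of_inflow K (((i, k), p) # ((j, k), 1 - s) # es) n)" for n
  proof -
    let ?T = "\<lambda>e l e' l'. {(a, b, ps). l \<le> a \<and> l' \<le> b \<and> ps \<in> flows es \<and>
      inflow K (((e, 0), a) # ((e', 0), b) # ps) = n}"
    \<comment> \<open>Here \<open>c\<close> is the common flow, carried by the new edge from
      \<open>i\<close> to \<open>k\<close>, and \<open>d\<close> is the excess on the edge that
      remains.\<close>
    let ?f = "\<lambda>(c, d, ps). (c + d, c, ps)" and ?g = "\<lambda>(c, d, ps). (c, c + d, ps)"
    have fin: "finite (?T (u, v) l (u', v') l')" if "u < v" "v < K" "u' < v'" "v' < K" for u v u' v' l l'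
      using bij_betw_finite[OF bij_betw_flows_Cons2[of "(u, v)" l "(u', v')" l' es K n]] that assms(4)
      by (simp add: finite_flows_of_inflow)
    have f: "inflow K ((((i, j), 0), c + d) # (((j, k), 0), c) # ps)
        = inflow K ((((i, k), 0), c) # (((i, j), 0), d) # ps)" for c d ps
      by (rule inflow_cong) (simp add: fun_eq_iff algebra_simps)
    have g: "inflow K ((((i, j), 0), c) # (((j, k), 0), c + d) # ps)
        = inflow K ((((i, k), 0), c) # (((j, k), 0), d) # ps)" for c d ps
      by (rule inflow_cong) (simp add: fun_eq_iff algebra_simps)
    have "?T (i, j) p (j, k) q = ?f ` ?T (i, k) q (i, j) s \<union> ?g ` ?T (i, k) p (j, k) (1 - s)"
    proof (intro equalityI subsetI)
      fix x assume x: "x \<in> ?T (i, j) p (j, k) q"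
      obtain a b ps where abs: "x = (a, b, ps)" by (cases x)
      show "x \<in> ?f ` ?T (i, k) q (i, j) s \<union> ?g ` ?T (i, k) p (j, k) (1 - s)"
      proof (cases "b + s \<le> a")
        case True
        then have "(b, a - b, ps) \<in> ?T (i, k) q (i, j) s"
          using x f[of b "a - b" ps] by (auto simp: abs)
        then show ?thesis using True by (force simp: abs image_iff)
      next
        case False
        then have "(a, b - a, ps) \<in> ?T (i, k) p (j, k) (1 - s)"
          using x g[of a "b - a" ps] s by (auto simp: abs)
        then show ?thesis using False s by (force simp: abs image_iff)
      qed
    \<comment> \<open>Conversely, the images meet the original bounds because \<open>c + d\<close>
      is at least \<open>q + s\<close>, hence at least \<open>p\<close>, in the first case and at
      least \<open>p + (1 - s)\<close>, hence at least \<open>q\<close>, in the second.\<close>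
    qed (use f g s in auto)
    moreover have "?f ` ?T (i, k) q (i, j) s \<inter> ?g ` ?T (i, k) p (j, k) (1 - s) = {}"
      using s(1) by auto
    ultimately have "card (?T (i, j) p (j, k) q) = card (?T (i, k) q (i, j) s) + card (?T (i, k) p (j, k) (1 - s))"
      using assms(1-3) fin by (simp add: card_Un_disjoint card_image inj_on_def)
    then show ?thesis
      by (simp only: bij_betw_same_card[OF bij_betw_flows_Cons2])
  qed
  then show ?thesis by (simp add: flow_gf_def fps_eq_iff)
qed

section \<open>The h-series and reciprocity\<close>

text \<open>Written as a power series, but a polynomial of degree at most \<open>length es\<close>
  for acyclic edges with bounds 0 and 1, by \<open>reciprocal_acyclic\<close>.\<close>

definition h_series :: "nat \<Rightarrow> hedge list \<Rightarrow> int fps" where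
  "h_series K es = (1 - fps_X) ^ length es * flow_gf K es"

text \<open>Exchanges the variables \<open>x_ij\<close> with the elements
  \<open>x_ij + beta\<close>. Because of truncated subtraction it is an involution only on bounds 0
  and 1.\<close>

definition toggle :: "hedge list \<Rightarrow> hedge list" where
  "toggle es = map (\<lambda>(e, l). (e, 1 - l)) es"

text \<open>The graph form of irreducibility: no vertex is both the head of an edge and the tail of
  another.\<close>

definition alternating :: "hedge list \<Rightarrow> bool" where
  "alternating es \<longleftrightarrow> (\<forall>((i, j), l)\<in>set es. \<forall>((j', k), l')\<in>set es. j \<noteq> j')"

text \<open>An exchange trades one edge for a strictly longer one, so this measure
  decreases.\<close>

definition weight :: "nat \<Rightarrow> hedge list \<Rightarrow> nat" where
  "weight K es = (\<Sum>((i, j), l)\<leftarrow>es. K - (j - i))"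

lemma h_series_mset_cong: "mset es = mset es' \<Longrightarrow> h_series K es = h_series K es'"
  using flow_gf_mset_cong[of es es' K] mset_eq_length[of es es'] by (simp add: h_series_def)

lemma acyclic_edges_mset_cong: "mset es = mset es' \<Longrightarrow> acyclic_edges K es = acyclic_edges K es'"
  using mset_eq_setD[of es es'] by (simp add: acyclic_edges_def)

lemma weight_Cons [simp]: "weight K (((i, j), l) # es) = K - (j - i) + weight K es"
  by (simp add: weight_def)

lemma weight_mset_cong:
  assumes "mset es = mset es'"
  shows "weight K es = weight K es'"
proof -
  have "weight K es = sum_mset (image_mset (\<lambda>((i, j), l). K - (j - i)) (mset es))" for es
    by (simp add: weight_def flip: sum_mset_sum_list)
  then show ?thesis using assms by simp
qed

lemma toggle_Nil [simp]: "toggle [] = []"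
  by (simp add: toggle_def)

lemma toggle_Cons [simp]: "toggle ((e, l) # es) = (e, 1 - l) # toggle es"
  by (simp add: toggle_def)

lemma length_toggle [simp]: "length (toggle es) = length es"
  by (simp add: toggle_def)

lemma toggle_mset_cong: "mset es = mset es' \<Longrightarrow> mset (toggle es) = mset (toggle es')"
  by (simp add: toggle_def)

lemma acyclic_edges_toggle [simp]: "acyclic_edges K (toggle es) = acyclic_edges K es"
  by (induction es) auto

lemma h_series_exchange:
  assumes "i < j" "j < k" "k < K" "acyclic_edges K es"
    and "s \<le> 1" "p \<le> q + s" "q + s \<le> p + 1"
  shows "h_series K (((i, j), p) # ((j, k), q) # es) =
         h_series K (((i, k), q) # ((i, j), s) # es) + h_series K (((i, k), p) # ((j, k), 1 - s) # es)"
  using flow_gf_exchange[OF assms] by (simp add: h_series_def algebra_simps)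

text \<open>With \<open>beta\<close> equal to \<open>t - 1\<close> this is the identity
  \<open>x = (x + beta) - beta\<close>.\<close>

lemma h_series_split_bound:
  assumes "acyclic_edges K ((e, 0) # es)"
  shows "h_series K ((e, 0) # es) = h_series K ((e, 1) # es) + (1 - fps_X) * h_series K es"
  using flow_gf_split_bound[OF assms] by (simp add: h_series_def algebra_simps)

section \<open>Alternating graphs\<close>

lemma sum_outflow:
  fixes ps :: "(hedge \<times> nat) list"
  assumes "\<And>i j l c. (((i, j), l), c) \<in> set ps \<Longrightarrow> i < K"
  shows "(\<Sum>v<K. \<Sum>(((i, j), l), c)\<leftarrow>ps. c * of_bool (i = v)) = sum_list (map snd ps)"
  using assms
proof (induction ps)
  case (Cons p ps)
  obtain i j l c where p: "p = (((i, j), l), c)" by (cases p) auto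
  have "i < K" using Cons.prems p by auto
  moreover have "(\<Sum>v<K. c * of_bool (i = v)) = (\<Sum>v<K. if i = v then c else 0)"
    by (intro sum.cong) auto
  ultimately have "(\<Sum>v<K. c * of_bool (i = v)) = c" by simp
  moreover have "(\<Sum>v<K. \<Sum>(((i, j), l), c)\<leftarrow>ps. c * of_bool (i = v)) = sum_list (map snd ps)"
    by (rule Cons.IH) (use Cons.prems in auto)
  ultimately show ?case by (simp add: p sum.distrib)
qed simp

text \<open>At each vertex all edges leave or all arrive, so the positive part of the divergence is
  exactly the outflow.\<close>

lemma inflow_alternating:
  assumes "acyclic_edges K es" "alternating es" "ps \<in> flows es"
  shows "inflow K ps = sum_list (map snd ps)"
proof -
  have es: "((i, j), l) \<in> set es" if "(((i, j), l), c) \<in> set ps" for i j l c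
    using assms(3) that by (force simp: flows_def)
  have out: "nat (divergence ps v) = (\<Sum>(((i, j), l), c)\<leftarrow>ps. c * of_bool (i = v))" for v
  proof (cases "\<exists>k l. ((v, k), l) \<in> set es")
    case True
    then have "j \<noteq> v" if "((i, j), l) \<in> set es" for i j l
      using assms(2) that unfolding alternating_def by fast
    then have "divergence ps v = (\<Sum>(((i, j), l), c)\<leftarrow>ps. int (c * of_bool (i = v)))"
      unfolding divergence_def by (intro arg_cong[of _ _ sum_list] map_cong refl) (use es in force)
    also have "\<dots> = int (\<Sum>(((i, j), l), c)\<leftarrow>ps. c * of_bool (i = v))"
      by (induction ps) auto
    finally show ?thesis by simp
  next
    case False
    then have nv: "i \<noteq> v" if "(((i, j), l), c) \<in> set ps" for i j l c
      using es that by blast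
    then have "divergence ps v \<le> (\<Sum>p\<leftarrow>ps. 0)"
      unfolding divergence_def by (intro sum_list_mono) auto
    moreover have "(\<Sum>(((i, j), l), c)\<leftarrow>ps. c * of_bool (i = v)) = (\<Sum>p\<leftarrow>ps. 0)"
      by (intro arg_cong[of _ _ sum_list] map_cong refl) (use nv in auto)
    ultimately show ?thesis by simp
  qed
  have "i < K" if "(((i, j), l), c) \<in> set ps" for i j l c
    using es[OF that] assms(1) by (force simp: acyclic_edges_def)
  then show ?thesis using sum_outflow[of ps K] by (simp add: inflow_def out)
qed

lemma flow_gf_raise_bound:
  assumes "\<And>c ps. ps \<in> flows es \<Longrightarrow> inflow K (((e, 0), Suc c) # ps) = Suc (inflow K (((e, 0), c) # ps))"
  shows "flow_gf K ((e, 1) # es) = fps_X * flow_gf K ((e, 0) # es)"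
proof (rule fps_ext)
  fix n
  let ?T = "\<lambda>l n. {(c, ps). l \<le> c \<and> ps \<in> flows es \<and> inflow K (((e, 0), c) # ps) = n}"
  have card: "card (flows_of_inflow K ((e, l) # es) n) = card (?T l n)" for l n
    using bij_betw_same_card[OF bij_betw_flows_Cons[of e l es K n]] by simp
  show "fps_nth (flow_gf K ((e, 1) # es)) n = fps_nth (fps_X * flow_gf K ((e, 0) # es)) n"
  proof (cases n)
    case 0
    have "(c, ps) \<notin> ?T 1 n" for c ps by (cases c) (simp_all add: assms 0)
    then have "?T 1 n = {}" by auto
    then have "card (flows_of_inflow K ((e, 1) # es) n) = 0" by (simp only: card card.empty)
    then show ?thesis by (simp add: 0 flow_gf_def)
  next
    case (Suc k)
    have inj: "inj (apfst Suc :: nat \<times> (hedge \<times> nat) list \<Rightarrow> _)" by (auto simp: inj_on_def)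
    have "?T 1 n = apfst Suc ` ?T 0 k"
    proof (rule set_eqI)
      fix x :: "nat \<times> (hedge \<times> nat) list"
      obtain c ps where x: "x = (c, ps)" by (cases x)
      show "x \<in> ?T 1 n \<longleftrightarrow> x \<in> apfst Suc ` ?T 0 k"
      proof (cases c)
        case (Suc d)
        have "x \<in> apfst Suc ` ?T 0 k \<longleftrightarrow> (d, ps) \<in> ?T 0 k"
          using inj_image_mem_iff[OF inj, of "(d, ps)" "?T 0 k"] by (simp add: x Suc)
        also have "\<dots> \<longleftrightarrow> x \<in> ?T 1 n"
          by (simp add: x Suc \<open>n = Suc k\<close> assms cong: conj_cong)
        finally show ?thesis by simp
      qed (simp add: x image_iff)
    qed
    then show ?thesis
      by (simp add: Suc flow_gf_def card card_image[OF inj_on_subset[OF inj subset_UNIV]])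
  qed
qed

text \<open>The inflow is the total flow, so an edge contributes the factor
  \<open>1 / (1 - t)\<close> or \<open>t / (1 - t)\<close> to \<open>flow_gf\<close>. The induction
  obtains this without division, from two relations between the bounds 0 and 1.\<close>

lemma h_series_alternating:
  assumes "acyclic_edges K es" "alternating es" "\<forall>(e, l)\<in>set es. l \<le> 1"
  shows "h_series K es = fps_X ^ sum_list (map snd es)"
  using assms
proof (induction es)
  case Nil
  have "flows_of_inflow K [] k = (if k = 0 then {[]} else {})" for k
    by (auto simp: flows_of_inflow_def inflow_def)
  then show ?case by (simp add: h_series_def flow_gf_def fps_eq_iff)
next
  case (Cons el es)
  obtain i j l where el: "el = ((i, j), l)" by (cases el) auto
  let ?e = "(i, j)"
  have ac: "acyclic_edges K ((?e, 0) # es)" using Cons.prems(1) by (simp add: el)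
  have alt: "alternating ((?e, 0) # es)" using Cons.prems(2) by (auto simp: alternating_def el)
  have IH: "h_series K es = fps_X ^ sum_list (map snd es)"
    by (rule Cons.IH) (use Cons.prems in \<open>auto simp: alternating_def el\<close>)
  have "inflow K (((?e, 0), c) # ps) = c + sum_list (map snd ps)" if "ps \<in> flows es" for c ps
    using inflow_alternating[OF ac alt, of "((?e, 0), c) # ps"] that by (simp add: flows_def)
  then have "flow_gf K ((?e, 1) # es) = fps_X * flow_gf K ((?e, 0) # es)"
    by (intro flow_gf_raise_bound) simp
  then have 1: "h_series K ((?e, 1) # es) = fps_X * h_series K ((?e, 0) # es)"
    by (simp add: h_series_def)
  \<comment> \<open>Eliminating the series with bound 1 leaves a common factor \<open>1 - t\<close>,
    which cancels in the integral domain of integer power series.\<close>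
  have "(1 - fps_X) * h_series K ((?e, 0) # es) = (1 - fps_X) * h_series K es"
    using h_series_split_bound[OF ac] 1 by (simp add: algebra_simps)
  moreover have "(1 - fps_X :: int fps) \<noteq> 0"
    by (metis diff_0_right fps_X_neq_one right_minus_eq)
  ultimately have 0: "h_series K ((?e, 0) # es) = h_series K es" by simp
  have "l = 0 \<or> l = 1" using Cons.prems(3) by (auto simp: el)
  then show ?case using 0 1 IH by (auto simp: el)
qed

text \<open>
  The induction carries \<open>es\<close> and \<open>toggle es\<close> together because \<open>h_series_exchange\<close> is stable under toggling
  all bounds (with \<open>s\<close> replaced by \<open>1 - s\<close>).
\<close>

definition reciprocal :: "nat \<Rightarrow> hedge list \<Rightarrow> bool" where
  "reciprocal K es \<longleftrightarrow> (\<forall>n. 0 \<le> fps_nth (h_series K es) n \<and> fps_nth (h_series K es) n =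
     (if n \<le> length es then fps_nth (h_series K (toggle es)) (length es - n) else 0))"

lemma exists_exchange:
  assumes "acyclic_edges K es" "\<not> alternating es"
  obtains i j k p q r where "mset es = mset (((i, j), p) # ((j, k), q) # r)"
proof -
  obtain i j k p q where 1: "((i, j), p) \<in> set es" and 2: "((j, k), q) \<in> set es"
    using assms(2) unfolding alternating_def by fast
  \<comment> \<open>The two edges differ because \<open>i < j\<close>, so removing the first keeps
    the second in the list.\<close>
  have "i < j" using 1 assms(1) by (auto simp: acyclic_edges_def)
  then have "((j, k), q) \<in> set (remove1 ((i, j), p) es)" using 2 by simp
  then have "mset es = mset (((i, j), p) # ((j, k), q) # remove1 ((j, k), q) (remove1 ((i, j), p) es))"
    using 1 by (metis mset_remove1 mset.simps(2) insert_DiffM set_mset_mset)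
  then show ?thesis using that by blast
qed

lemma reciprocal_acyclic:
  assumes "acyclic_edges K es" "\<forall>(e, l)\<in>set es. l \<le> 1"
  shows "reciprocal K es"
  using assms
proof (induction "weight K es" arbitrary: es rule: less_induct)
  case less
  show ?case
  proof (cases "alternating es")
    case True
    then have "alternating (toggle es)" by (force simp: alternating_def toggle_def)
    moreover have "\<forall>(e, l)\<in>set (toggle es). l \<le> 1" by (auto simp: toggle_def)
    ultimately have "h_series K (toggle es) = fps_X ^ sum_list (map snd (toggle es))"
      using less.prems by (intro h_series_alternating) simp_all
    moreover have "h_series K es = fps_X ^ sum_list (map snd es)"
      using True less.prems by (intro h_series_alternating) simp_all
    \<comment> \<open>Toggling complements the exponent with respect to the number of edges, which
      is reciprocity for a single power.\<close>
    moreover have "sum_list (map snd es) + sum_list (map snd (toggle es)) = length es"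
      using less.prems(2) by (induction es) auto
    ultimately show ?thesis
      by (auto simp: reciprocal_def fps_X_power_nth)
  next
    case False
    obtain i j k p q r where es: "mset es = mset (((i, j), p) # ((j, k), q) # r)"
      using exists_exchange[OF less.prems(1) False] .
    let ?es = "((i, j), p) # ((j, k), q) # r"
    have ac: "acyclic_edges K ?es" using less.prems(1) acyclic_edges_mset_cong[OF es] by simp
    then have ij: "i < j" "j < k" "k < K" and r: "acyclic_edges K r" by auto
    have le: "\<forall>(e, l)\<in>set ?es. l \<le> 1" using less.prems(2) mset_eq_setD[OF es] by simp
    then have pq: "p \<le> 1" "q \<le> 1" by auto
    \<comment> \<open>For bounds 0 and 1 the offset is forced when \<open>p\<close> and
      \<open>q\<close> differ; for equal bounds either value would do.\<close>
    define s where "s = (if q < p then 1 else 0 :: nat)"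
    have s: "s \<le> 1" "p \<le> q + s" "q + s \<le> p + 1" using pq by (auto simp: s_def)
    have s': "1 - s \<le> 1" "1 - p \<le> 1 - q + (1 - s)" "1 - q + (1 - s) \<le> 1 - p + 1"
      using pq s by auto
    let ?A = "((i, k), q) # ((i, j), s) # r" and ?B = "((i, k), p) # ((j, k), 1 - s) # r"
    have w: "weight K ?A < weight K es" "weight K ?B < weight K es"
      using ij weight_mset_cong[OF es, of K] by auto
    have A: "reciprocal K ?A" by (rule less.hyps) (use ij w r le s in auto)
    have B: "reciprocal K ?B" by (rule less.hyps) (use ij w r le s in auto)
    have h: "h_series K es = h_series K ?A + h_series K ?B"
      using h_series_mset_cong[OF es] h_series_exchange[OF ij r s] by simp
    have "h_series K (toggle es) = h_series K (toggle ?es)"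
      by (rule h_series_mset_cong[OF toggle_mset_cong[OF es]])
    also have "\<dots> = h_series K (toggle ?A) + h_series K (toggle ?B)"
      using h_series_exchange[OF ij _ s', of "toggle r"] r s(1) by simp
    finally have h': "h_series K (toggle es) = h_series K (toggle ?A) + h_series K (toggle ?B)" .
    have len: "length es = length r + 2" using mset_eq_length[OF es] by simp
    show ?thesis unfolding reciprocal_def
    proof (intro allI conjI)
      fix n
      have "0 \<le> fps_nth (h_series K ?A) n" "0 \<le> fps_nth (h_series K ?B) n"
        using A B unfolding reciprocal_def by blast+
      then show "0 \<le> fps_nth (h_series K es) n" unfolding h by simp
      have "fps_nth (h_series K X) n =
          (if n \<le> length es then fps_nth (h_series K (toggle X)) (length es - n) else 0)"
        if "X = ?A \<or> X = ?B" for X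
        using A B that len unfolding reciprocal_def by (metis add_2_eq_Suc' length_Cons)
      then show "fps_nth (h_series K es) n =
          (if n \<le> length es then fps_nth (h_series K (toggle es)) (length es - n) else 0)"
        unfolding h h' by simp
    qed
  qed
qed

section \<open>Monomials and reduction\<close>

text \<open>The order picked by \<open>SOME\<close> is irrelevant, since \<open>h_series\<close> and
  \<open>weight\<close> depend only on the multiset of edges.\<close>

definition edges_of :: "xmonom \<Rightarrow> hedge list" where
  "edges_of M = (SOME es. \<forall>e l. count (mset es) (e, l) = (if l = 0 then Poly_Mapping.lookup M e else 0))"

lemma count_edges_of: "count (mset (edges_of M)) (e, l) = (if l = 0 then Poly_Mapping.lookup M e else 0)"
proof -
  let ?f = "\<lambda>(e, l :: nat). if l = 0 then Poly_Mapping.lookup M e else 0"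
  have "{x. 0 < ?f x} = Poly_Mapping.keys M \<times> {0}"
    by (auto simp: in_keys_iff split: if_splits)
  then have f: "count (Abs_multiset ?f) = ?f" by (intro count_Abs_multiset) simp
  obtain es where "mset es = Abs_multiset ?f" using ex_mset by blast
  then have "\<forall>e l. count (mset es) (e, l) = (if l = 0 then Poly_Mapping.lookup M e else 0)"
    by (simp add: f)
  then show ?thesis unfolding edges_of_def by (rule someI2) blast
qed

lemma set_edges_of: "set (edges_of M) = Poly_Mapping.keys M \<times> {0}"
proof (rule set_eqI)
  fix x :: hedge
  obtain e l where x: "x = (e, l)" by (cases x)
  have "x \<in> set (edges_of M) \<longleftrightarrow> count (mset (edges_of M)) x \<noteq> 0"
    by (simp only: count_eq_zero_iff set_mset_mset not_not)
  also have "\<dots> \<longleftrightarrow> x \<in> Poly_Mapping.keys M \<times> {0}"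
    unfolding x count_edges_of by (simp add: in_keys_iff)
  finally show "x \<in> set (edges_of M) \<longleftrightarrow> x \<in> Poly_Mapping.keys M \<times> {0}" .
qed

lemma mset_edges_of_add: "mset (edges_of (M + N)) = mset (edges_of M @ edges_of N)"
proof (rule multiset_eqI)
  fix x show "count (mset (edges_of (M + N))) x = count (mset (edges_of M @ edges_of N)) x"
    by (cases x) (simp add: count_edges_of lookup_add)
qed

lemma mset_edges_of_xmon: "mset (edges_of (xmon i j)) = mset [((i, j), 0)]"
proof (rule multiset_eqI)
  fix x show "count (mset (edges_of (xmon i j))) x = count (mset [((i, j), 0)]) x"
    by (cases x) (auto simp: count_edges_of xmon_def lookup_single when_def)
qed

lemma edges_of_zero [simp]: "edges_of 0 = []"
proof -
  have "set (edges_of 0) = {}" by (simp add: set_edges_of)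
  then show ?thesis by simp
qed

definition valid_monom :: "nat \<Rightarrow> xmonom \<Rightarrow> bool" where
  "valid_monom K M \<longleftrightarrow> (\<forall>(i, j)\<in>Poly_Mapping.keys M. i < j \<and> j < K)"

lemma acyclic_edges_of: "acyclic_edges K (edges_of M) \<longleftrightarrow> valid_monom K M"
  by (auto simp: acyclic_edges_def valid_monom_def set_edges_of)

lemma alternating_edges_of:
  assumes "valid_monom K M"
  shows "alternating (edges_of M) \<longleftrightarrow> (\<nexists>i j k. replaceable M i j k)"
proof -
  have "i < j" if "(i, j) \<in> Poly_Mapping.keys M" for i j
    using assms that by (auto simp: valid_monom_def)
  moreover have "alternating (edges_of M) \<longleftrightarrow>
      (\<forall>i j k. (i, j) \<in> Poly_Mapping.keys M \<longrightarrow> (j, k) \<notin> Poly_Mapping.keys M)"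
    unfolding alternating_def set_edges_of by fastforce
  ultimately show ?thesis
    unfolding replaceable_def by (metis in_keys_iff neq0_conv)
qed

lemma keys_add_nat:
  fixes M N :: "'a \<Rightarrow>\<^sub>0 nat"
  shows "Poly_Mapping.keys (M + N) = Poly_Mapping.keys M \<union> Poly_Mapping.keys N"
  by (auto simp: in_keys_iff lookup_add)

lemma valid_monom_add: "valid_monom K (M + N) \<longleftrightarrow> valid_monom K M \<and> valid_monom K N"
  by (auto simp: valid_monom_def keys_add_nat)

lemma valid_monom_xmon: "valid_monom K (xmon i j) \<longleftrightarrow> i < j \<and> j < K"
  by (simp add: valid_monom_def xmon_def)

definition h_monom :: "nat \<Rightarrow> xmonom \<Rightarrow> int fps" where
  "h_monom K M = h_series K (edges_of M)"

definition monom_weight :: "nat \<Rightarrow> xmonom \<Rightarrow> nat" where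
  "monom_weight K M = weight K (edges_of M)"

lemma monom_weight_add_xmon: "monom_weight K (M + xmon i j) = monom_weight K M + (K - (j - i))"
proof -
  have "mset (edges_of (M + xmon i j)) = mset (((i, j), 0) # edges_of M)"
    by (simp add: mset_edges_of_add mset_edges_of_xmon)
  from weight_mset_cong[OF this] show ?thesis by (simp add: monom_weight_def)
qed

text \<open>Exchanging with all bounds and the offset 0 leaves bound 1 on the edge
  \<open>(j, k)\<close> of the second product; lowering that bound produces the term with factor
  \<open>beta\<close>, that is \<open>t - 1\<close>.\<close>

lemma h_monom_replace:
  assumes "i < j" "j < k" "k < K" "valid_monom K R"
  shows "h_monom K (R + xmon i j + xmon j k) =
    h_monom K (R + xmon i k + xmon i j) + h_monom K (R + xmon j k + xmon i k)
      + (fps_X - 1) * h_monom K (R + xmon i k)"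
proof -
  let ?r = "edges_of R"
  have r: "acyclic_edges K ?r" using assms(4) by (simp add: acyclic_edges_of)
  have 1: "h_monom K (R + xmon a b) = h_series K (((a, b), 0) # ?r)" for a b
    unfolding h_monom_def
    by (rule h_series_mset_cong) (simp add: mset_edges_of_add mset_edges_of_xmon)
  have 2: "h_monom K (R + xmon a b + xmon c d) = h_series K (((a, b), 0) # ((c, d), 0) # ?r)" for a b c d
    unfolding h_monom_def
    by (rule h_series_mset_cong) (simp add: mset_edges_of_add mset_edges_of_xmon)
  have swap: "h_series K (x # y # ?r) = h_series K (y # x # ?r)" for x y
    by (rule h_series_mset_cong) simp
  show ?thesis
    unfolding 1 2
    using h_series_exchange[OF assms(1-3) r, of 0 0 0] assms(1-3) r
      h_series_split_bound[of K "(j, k)" "((i, k), 0) # ?r"]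
    by (simp add: swap[of "((i, k), 0)" "((j, k), Suc 0)"] algebra_simps)
qed

text \<open>The substitution \<open>\<beta> = t - 1\<close>, with \<open>t\<close> the variable of the generating functions.\<close>

definition shift_beta :: "int poly \<Rightarrow> int fps" where
  "shift_beta c = fps_of_poly (pcompose c [:-1, 1:])"

lemma shift_beta_0 [simp]: "shift_beta 0 = 0"
  and shift_beta_1 [simp]: "shift_beta 1 = 1"
  and shift_beta_add: "shift_beta (a + b) = shift_beta a + shift_beta b"
  and shift_beta_mult: "shift_beta (a * b) = shift_beta a * shift_beta b"
  by (simp_all add: shift_beta_def pcompose_add pcompose_mult fps_of_poly_add fps_of_poly_mult pcompose_1)

lemma shift_beta_beta: "shift_beta beta = fps_X - 1"
proof -
  have "pcompose beta [:-1, 1:] = [:0, 1:] - 1" by (simp add: beta_def pcompose_pCons one_pCons)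
  then show ?thesis by (simp only: shift_beta_def fps_of_poly_diff fps_of_poly_fps_X fps_of_poly_1)
qed

text \<open>The substitution is undone by replacing \<open>t\<close> with
  \<open>beta + 1\<close>.\<close>

lemma inj_shift_beta: "shift_beta a = shift_beta b \<Longrightarrow> a = b"
proof -
  assume "shift_beta a = shift_beta b"
  then have "pcompose a [:-1, 1:] = pcompose b [:-1, 1:]"
    by (simp add: shift_beta_def fps_of_poly_eq_iff)
  then have "pcompose (pcompose a [:-1, 1:]) [:1, 1:] = pcompose (pcompose b [:-1, 1:]) [:1, 1:]" by simp
  moreover have "pcompose [:-1, 1:] [:1, 1:] = [:0, 1 :: int:]" by (simp add: pcompose_pCons)
  ultimately show "a = b" by (simp flip: pcompose_assoc add: pcompose_idR)
qed

text \<open>The linear extension of \<open>h_monom\<close>: an invariant of reduction that becomes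
  the value at \<open>x_ij = 1\<close> once no replacement is possible.\<close>

definition shifted_value :: "nat \<Rightarrow> xpoly \<Rightarrow> int fps" where
  "shifted_value K Q = (\<Sum>M\<in>Poly_Mapping.keys Q. shift_beta (Poly_Mapping.lookup Q M) * h_monom K M)"

lemma shifted_value_single [simp]: "shifted_value K (Poly_Mapping.single M c) = shift_beta c * h_monom K M"
  by (simp add: shifted_value_def)

lemma shifted_value_superset:
  assumes "finite S" "Poly_Mapping.keys Q \<subseteq> S"
  shows "shifted_value K Q = (\<Sum>M\<in>S. shift_beta (Poly_Mapping.lookup Q M) * h_monom K M)"
  unfolding shifted_value_def
  by (rule sum.mono_neutral_left) (use assms in \<open>auto simp: in_keys_iff\<close>)

lemma shifted_value_add: "shifted_value K (P + Q) = shifted_value K P + shifted_value K Q"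
proof -
  let ?S = "Poly_Mapping.keys P \<union> Poly_Mapping.keys Q"
  have "Poly_Mapping.keys (P + Q) \<subseteq> ?S" by (rule keys_add)
  then show ?thesis
    by (simp add: shifted_value_superset[of ?S] lookup_add shift_beta_add ring_distribs sum.distrib)
qed

definition valid_poly :: "nat \<Rightarrow> xpoly \<Rightarrow> bool" where
  "valid_poly K Q \<longleftrightarrow> (\<forall>M\<in>Poly_Mapping.keys Q. valid_monom K M)"

text \<open>
  A step replaces one monomial by at most three of smaller weight, so base \<open>4\<close> makes this decrease.
\<close>

definition potential :: "nat \<Rightarrow> xpoly \<Rightarrow> nat" where
  "potential K Q = (\<Sum>M\<in>Poly_Mapping.keys Q. 4 ^ monom_weight K M)"

lemma reduction_step_result:
  "Poly_Mapping.single R c * (X i k * X i j + X j k * X i k + xconst beta * X i k) =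
    Poly_Mapping.single (R + xmon i k + xmon i j) c + Poly_Mapping.single (R + xmon j k + xmon i k) c
      + Poly_Mapping.single (R + xmon i k) (c * beta)"
  by (simp add: X_def xconst_def mult_single ring_distribs ac_simps)

lemma reduction_step_preserves:
  assumes "reduction_step P Q" "valid_poly K P"
  shows "valid_poly K Q" "shifted_value K Q = shifted_value K P" "potential K Q < potential K P"
proof -
  from assms(1) obtain M i j k R c r where
    lr: "leftmost_replaceable M i j k" and M: "M = R + xmon i j + xmon j k" and "c \<noteq> 0"
    and r: "M \<notin> Poly_Mapping.keys r" and P: "P = Poly_Mapping.single M c + r"
    and Q: "Q = Poly_Mapping.single (R + xmon i k + xmon i j) c + Poly_Mapping.single (R + xmon j k + xmon i k) c
      + Poly_Mapping.single (R + xmon i k) (c * beta) + r"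
    by cases (simp add: reduction_step_result)
  let ?A = "R + xmon i k + xmon i j" and ?B = "R + xmon j k + xmon i k" and ?C = "R + xmon i k"
  have keysP: "Poly_Mapping.keys P = insert M (Poly_Mapping.keys r)"
  proof -
    have "Poly_Mapping.lookup r M = 0" using r by (simp add: in_keys_iff)
    then have "Poly_Mapping.lookup P N = (if N = M then c else Poly_Mapping.lookup r N)" for N
      by (simp add: P lookup_add lookup_single when_def)
    then show ?thesis using \<open>c \<noteq> 0\<close> by (auto simp: in_keys_iff split: if_splits)
  qed
  \<comment> \<open>New terms may merge with old ones or cancel, so only an inclusion holds; it
    suffices for bounding the potential from above.\<close>
  have keysQ: "Poly_Mapping.keys Q \<subseteq> {?A, ?B, ?C} \<union> Poly_Mapping.keys r"
    by (auto simp: Q in_keys_iff lookup_add lookup_single when_def split: if_splits)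
  have ij: "i < j" "j < k" using lr by (auto simp: leftmost_replaceable_def replaceable_def)
  have "valid_monom K M" using assms(2) keysP by (simp add: valid_poly_def)
  then have R: "valid_monom K R" and K: "k < K" by (auto simp: M valid_monom_add valid_monom_xmon)
  then have "valid_monom K ?A" "valid_monom K ?B" "valid_monom K ?C"
    using ij by (auto simp: valid_monom_add valid_monom_xmon)
  then show "valid_poly K Q" using keysQ assms(2) by (auto simp: valid_poly_def keysP)
  show "shifted_value K Q = shifted_value K P"
    unfolding P Q M shifted_value_add shifted_value_single h_monom_replace[OF ij K R]
      shift_beta_mult shift_beta_beta
    by (simp add: algebra_simps)
  have "monom_weight K ?A < monom_weight K M" "monom_weight K ?B < monom_weight K M"
    "monom_weight K ?C < monom_weight K M"
    using ij K by (auto simp: M monom_weight_add_xmon)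
  then have w: "\<forall>N\<in>{?A, ?B, ?C}. 4 * 4 ^ monom_weight K N \<le> (4 :: nat) ^ monom_weight K M"
    by (auto simp: Suc_le_eq simp flip: power_Suc intro!: power_increasing)
  have "potential K Q \<le> (\<Sum>N\<in>{?A, ?B, ?C} \<union> Poly_Mapping.keys r. 4 ^ monom_weight K N)"
    unfolding potential_def by (rule sum_mono2) (use keysQ in auto)
  also have "\<dots> \<le> (\<Sum>N\<in>{?A, ?B, ?C}. 4 ^ monom_weight K N) + (\<Sum>N\<in>Poly_Mapping.keys r. 4 ^ monom_weight K N)"
    using sum.union_inter[of "{?A, ?B, ?C}" "Poly_Mapping.keys r" "\<lambda>N. (4 :: nat) ^ monom_weight K N"]
    by (metis finite.emptyI finite_insert finite_keys le_add1)
  also have "(\<Sum>N\<in>{?A, ?B, ?C}. 4 ^ monom_weight K N) \<le> (4 :: nat) ^ monom_weight K ?A + 4 ^ monom_weight K ?B + 4 ^ monom_weight K ?C"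
    by (simp add: sum.insert_if)
  also have "\<dots> < 4 ^ monom_weight K M"
  proof -
    have "4 * 4 ^ monom_weight K ?A \<le> (4 :: nat) ^ monom_weight K M"
      "4 * 4 ^ monom_weight K ?B \<le> (4 :: nat) ^ monom_weight K M"
      "4 * 4 ^ monom_weight K ?C \<le> (4 :: nat) ^ monom_weight K M"
      using w by blast+
    moreover have "0 < (4 :: nat) ^ monom_weight K M" by simp
    ultimately show ?thesis by linarith
  qed
  finally show "potential K Q < potential K P"
    using r by (simp add: potential_def keysP)
qed

section \<open>Existence and uniqueness of the reduced value\<close>

lemma reduction_steps_preserve:
  assumes "reduction_step\<^sup>*\<^sup>* P Q" "valid_poly K P"
  shows "valid_poly K Q \<and> shifted_value K Q = shifted_value K P"
  using assms by (induction rule: rtranclp_induct) (auto dest: reduction_step_preserves)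

text \<open>A replaceable triple with least sum \<open>i + j + k\<close> is minimal in the
  componentwise order.\<close>

lemma exists_leftmost_replaceable:
  assumes "replaceable M i j k"
  obtains i' j' k' where "leftmost_replaceable M i' j' k'"
proof -
  let ?P = "\<lambda>(i, j, k). replaceable M i j k" and ?m = "\<lambda>(i, j, k). i + j + k :: nat"
  have "?P (i, j, k)" using assms by simp
  from ex_has_least_nat[of ?P, OF this, of ?m]
  obtain a b c where x: "replaceable M a b c"
    and min: "\<And>a' b' c'. replaceable M a' b' c' \<Longrightarrow> a + b + c \<le> a' + b' + c'" by auto
  have "a' = a \<and> b' = b \<and> c' = c" if "replaceable M a' b' c'" "a' \<le> a" "b' \<le> b" "c' \<le> c" for a' b' c'
    using min[OF that(1)] that(2-) by linarith
  then show ?thesis using x that unfolding leftmost_replaceable_def by blast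
qed

lemma exists_reduced_poly:
  assumes "valid_poly K P"
  shows "\<exists>Q. reduced_poly_of P Q"
  using assms
proof (induction "potential K P" arbitrary: P rule: less_induct)
  case less
  show ?case
  proof (cases "\<exists>M\<in>Poly_Mapping.keys P. \<exists>i j k. replaceable M i j k")
    case False
    then show ?thesis unfolding reduced_poly_of_def by blast
  next
    case True
    then obtain M i j k where M: "M \<in> Poly_Mapping.keys P" and lr: "leftmost_replaceable M i j k"
      by (metis exists_leftmost_replaceable)
    \<comment> \<open>The truncated subtraction of exponents is exact: both exponents are positive,
      and \<open>i < j\<close> makes the two variables distinct.\<close>
    define R where "R = M - xmon i j - xmon j k"
    have MR: "M = R + xmon i j + xmon j k"
      using lr by (intro poly_mapping_eqI)
        (auto simp: R_def leftmost_replaceable_def replaceable_def lookup_add lookup_minus xmon_def lookup_single when_def)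
    define r where "r = P - Poly_Mapping.single M (Poly_Mapping.lookup P M)"
    have "P = Poly_Mapping.single M (Poly_Mapping.lookup P M) + r" by (simp add: r_def)
    moreover have "M \<notin> Poly_Mapping.keys r" by (simp add: r_def in_keys_iff lookup_minus)
    moreover have "Poly_Mapping.lookup P M \<noteq> 0" using M by (simp add: in_keys_iff)
    ultimately obtain Q where step: "reduction_step P Q"
      using reduction_step.intros[OF lr MR] by metis
    then obtain Q' where "reduced_poly_of Q Q'"
      using less.hyps reduction_step_preserves[OF step less.prems] by blast
    then show ?thesis
      using step unfolding reduced_poly_of_def by (meson converse_rtranclp_into_rtranclp)
  qed
qed

lemma shift_beta_sum: "shift_beta (sum f A) = (\<Sum>x\<in>A. shift_beta (f x))"
  by (induction A rule: infinite_finite_induct) (simp_all add: shift_beta_add)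

text \<open>A monomial without replaceable products has alternating edges, all with bound 0, so its
  series is \<open>t^0 = 1\<close>; what remains is the sum of the shifted coefficients.\<close>

lemma shift_beta_xeval_reduced:
  assumes "reduced_poly_of P Q" "valid_poly K P"
  shows "shift_beta (xeval (\<lambda>_. 1) Q) = shifted_value K P"
proof -
  have Q: "valid_poly K Q" "shifted_value K Q = shifted_value K P"
    using assms reduction_steps_preserve by (auto simp: reduced_poly_of_def)
  have "h_monom K M = 1" if "M \<in> Poly_Mapping.keys Q" for M
  proof -
    have v: "valid_monom K M" using Q(1) that by (simp add: valid_poly_def)
    then have "alternating (edges_of M)"
      using assms(1) that alternating_edges_of by (auto simp: reduced_poly_of_def)
    then have "h_monom K M = fps_X ^ sum_list (map snd (edges_of M))"
      unfolding h_monom_def using v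
      by (intro h_series_alternating) (auto simp: acyclic_edges_of set_edges_of)
    moreover have "map snd (edges_of M) = map (\<lambda>_. 0) (edges_of M)"
      by (rule map_cong) (auto simp: set_edges_of)
    ultimately show ?thesis by simp
  qed
  then have "shifted_value K Q = (\<Sum>M\<in>Poly_Mapping.keys Q. shift_beta (Poly_Mapping.lookup Q M))"
    unfolding shifted_value_def by (intro sum.cong) auto
  then show ?thesis by (simp add: xeval_def shift_beta_sum flip: Q(2))
qed

text \<open>All reduced polynomials of \<open>P\<close> share one shifted value and
  \<open>shift_beta\<close> is injective, so the \<open>THE\<close> in \<open>reduced_value\<close>
  is well defined.\<close>

lemma shift_beta_reduced_value:
  assumes "valid_poly K P"
  shows "shift_beta (reduced_value P) = shifted_value K P"
proof -
  obtain Q where Q: "reduced_poly_of P Q" using exists_reduced_poly[OF assms] by blast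
  have "reduced_value P = xeval (\<lambda>_. 1) Q"
    unfolding reduced_value_def
  proof (rule the_equality)
    fix p assume "\<exists>Q'. reduced_poly_of P Q' \<and> p = xeval (\<lambda>_. 1) Q'"
    then show "p = xeval (\<lambda>_. 1) Q"
      using shift_beta_xeval_reduced[OF _ assms] Q by (metis inj_shift_beta)
  qed (use Q in blast)
  then show ?thesis using shift_beta_xeval_reduced[OF Q assms] by simp
qed

section \<open>Powers of the path monomial\<close>

text \<open>The bound rises with the value, so flows with all bounds 0 become flows on the toggled
  edges.\<close>

definition raise_flow :: "(hedge \<times> nat) list \<Rightarrow> (hedge \<times> nat) list" where
  "raise_flow = map (\<lambda>((e, l), c). ((e, Suc l), Suc c))"

lemma inj_raise_flow: "inj raise_flow"
  unfolding raise_flow_def by (rule inj_mapI) (auto simp: inj_def)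

lemma flows_toggle:
  assumes "\<forall>(e, l)\<in>set es. l = 0"
  shows "flows (toggle es) = raise_flow ` flows es"
  using assms
proof (induction es)
  case (Cons el es)
  obtain e where el: "el = (e, 0)" using Cons.prems by (cases el) auto
  have IH: "flows (toggle es) = raise_flow ` flows es" using Cons by simp
  show ?case
  proof (intro equalityI subsetI)
    fix qs assume "qs \<in> flows (toggle (el # es))"
    then obtain c ps where "qs = ((e, 1), c) # raise_flow ps" "1 \<le> c" "ps \<in> flows es"
      by (auto simp: el flows_Cons IH)
    then have "qs = raise_flow (((e, 0), c - 1) # ps)" "((e, 0), c - 1) # ps \<in> flows (el # es)"
      by (auto simp: el flows_Cons raise_flow_def image_iff)
    then show "qs \<in> raise_flow ` flows (el # es)" by blast
  next
    fix qs assume "qs \<in> raise_flow ` flows (el # es)"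
    then obtain c ps where "qs = raise_flow (((e, 0), c) # ps)" "ps \<in> flows es"
      by (auto simp: el flows_Cons)
    then have "qs = ((e, 1), Suc c) # raise_flow ps" "raise_flow ps \<in> flows (toggle es)"
      by (auto simp: IH raise_flow_def)
    then show "qs \<in> flows (toggle (el # es))" by (auto simp: el flows_Cons image_iff)
  qed
qed (simp add: raise_flow_def)

lemma divergence_raise_flow:
  assumes "map fst ps = es"
  shows "divergence (raise_flow ps) v =
    divergence ps v + (\<Sum>((i, j), l)\<leftarrow>es. of_bool (i = v) - of_bool (j = v))"
  using assms
proof (induction ps arbitrary: es)
  case (Cons p ps)
  obtain i j l c where p: "p = (((i, j), l), c)" by (cases p) auto
  have "divergence (raise_flow ps) v =
      divergence ps v + (\<Sum>((i, j), l)\<leftarrow>map fst ps. of_bool (i = v) - of_bool (j = v))"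
    by (rule Cons.IH) simp
  then show ?case using Cons.prems by (auto simp: p raise_flow_def algebra_simps)
qed (simp add: raise_flow_def)

text \<open>
  Adding one unit to every edge changes the divergence only at the source \<open>a\<close> and the sink \<open>b\<close>.
\<close>

lemma flow_gf_toggle_balanced:
  assumes "\<forall>(e, l)\<in>set es. l = 0"
    and bal: "\<And>v. (\<Sum>((i, j), l)\<leftarrow>es. of_bool (i = v) - of_bool (j = v) :: int) = int m * (of_bool (v = a) - of_bool (v = b))"
    and "a \<noteq> b" "a < K" and ab: "\<forall>((i, j), l)\<in>set es. j \<noteq> a \<and> i \<noteq> b"
  shows "flow_gf K (toggle es) = fps_X ^ m * flow_gf K es"
proof -
  have inflow: "inflow K (raise_flow ps) = inflow K ps + m" if "ps \<in> flows es" for ps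
  proof -
    have ps: "map fst ps = es" using that by (simp add: flows_def)
    have mem: "j \<noteq> a \<and> i \<noteq> b" if "(((i, j), l), c) \<in> set ps" for i j l c
      using ab that ps by force
    \<comment> \<open>No edge enters \<open>a\<close> and none leaves \<open>b\<close>. Hence the
      positive part at \<open>a\<close> grows by exactly \<open>m\<close>, and the one at
      \<open>b\<close> stays 0.\<close>
    have "(\<Sum>p\<leftarrow>ps. 0) \<le> divergence ps a" unfolding divergence_def
      by (intro sum_list_mono) (use mem in \<open>auto simp: of_bool_def\<close>)
    then have a: "0 \<le> divergence ps a" by simp
    have "divergence ps b \<le> (\<Sum>p\<leftarrow>ps. 0)" unfolding divergence_def
      by (intro sum_list_mono) (use mem in \<open>auto simp: of_bool_def\<close>)
    then have b: "divergence ps b \<le> 0" by simp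
    have "nat (divergence (raise_flow ps) v) = nat (divergence ps v) + (if v = a then m else 0)" for v
      using a b \<open>a \<noteq> b\<close> by (auto simp: divergence_raise_flow[OF ps] bal)
    then show ?thesis using \<open>a < K\<close> by (simp add: inflow_def sum.distrib)
  qed
  show ?thesis
  proof (rule fps_ext)
    fix n
    have "flows_of_inflow K (toggle es) n = (if n < m then {} else raise_flow ` flows_of_inflow K es (n - m))"
      using inflow by (auto simp: flows_of_inflow_def flows_toggle[OF assms(1)])
    then show "fps_nth (flow_gf K (toggle es)) n = fps_nth (fps_X ^ m * flow_gf K es) n"
      by (simp add: flow_gf_def fps_X_power_mult_nth card_image[OF inj_on_subset[OF inj_raise_flow subset_UNIV]])
  qed
qed

text \<open>Every value is bounded by the inflow, so only the zero flow has inflow 0. The symmetry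
  proof uses this to find the exact degree.\<close>

lemma h_series_constant_coeff:
  assumes "acyclic_edges K es" "\<forall>(e, l)\<in>set es. l = 0"
  shows "fps_nth (h_series K es) 0 = 1"
proof -
  have "flows_of_inflow K es 0 = {map (\<lambda>e. (e, 0)) es}"
  proof (intro equalityI subsetI)
    fix ps assume "ps \<in> flows_of_inflow K es 0"
    then have ps: "ps \<in> flows es" "inflow K ps = 0" by (auto simp: flows_of_inflow_def)
    then have "snd p = 0" if "p \<in> set ps" for p
      using flow_le_inflow[OF assms(1) ps(1), of "fst p" "snd p"] that by simp
    then have "ps = map (\<lambda>e. (e, 0)) (map fst ps)"
      by (intro nth_equalityI) (auto simp: prod_eq_iff)
    moreover have "map fst ps = es" using ps(1) by (simp add: flows_def)
    ultimately show "ps \<in> {map (\<lambda>e. (e, 0)) es}" by (simp del: map_map)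
  next
    have "divergence (map (\<lambda>e. (e, 0)) es) v = 0" for v
      by (induction es) auto
    then show "ps \<in> flows_of_inflow K es 0" if "ps \<in> {map (\<lambda>e. (e, 0)) es}" for ps
      using assms(2) that by (auto simp: flows_of_inflow_def flows_def inflow_def comp_def)
  qed
  then have "fps_nth (flow_gf K es) 0 = 1" by (simp add: flow_gf_def)
  then show ?thesis by (simp add: h_series_def fps_power_zeroth)
qed

definition path_edges :: "nat \<Rightarrow> nat \<Rightarrow> hedge list" where
  "path_edges n m = concat (replicate m (map (\<lambda>i. ((i, Suc i), 0)) [1..<n]))"

lemma set_path_edges: "set (path_edges n m) \<subseteq> (\<lambda>i. ((i, Suc i), 0)) ` {1..<n}"
  by (auto simp: path_edges_def)

lemma length_path_edges: "length (path_edges n m) = m * (n - 1)"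
  by (induction m) (auto simp: path_edges_def)

lemma acyclic_path_edges: "acyclic_edges (Suc n) (path_edges n m)"
  using set_path_edges[of n m] by (auto simp: acyclic_edges_def)

text \<open>Each copy of the path enters and leaves every inner vertex once, so the sum telescopes
  to the two ends.\<close>

lemma path_edges_balance:
  assumes "1 \<le> n"
  shows "(\<Sum>((i, j), l)\<leftarrow>path_edges n m. of_bool (i = v) - of_bool (j = v) :: int) =
    int m * (of_bool (v = 1) - of_bool (v = n))"
proof -
  have "(\<Sum>((i, j), l)\<leftarrow>map (\<lambda>i. ((i, Suc i), 0 :: nat)) [1..<n]. of_bool (i = v) - of_bool (j = v) :: int) =
      of_bool (v = 1) - of_bool (v = n)"
    using assms by (induction n rule: nat_induct_at_least) auto
  then show ?thesis
    by (induction m) (auto simp: path_edges_def algebra_simps)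
qed

lemma h_series_toggle_path:
  assumes "2 \<le> n"
  shows "h_series (Suc n) (toggle (path_edges n m)) = fps_X ^ m * h_series (Suc n) (path_edges n m)"
proof -
  have "flow_gf (Suc n) (toggle (path_edges n m)) = fps_X ^ m * flow_gf (Suc n) (path_edges n m)"
    by (rule flow_gf_toggle_balanced[where a = 1 and b = n])
      (use assms set_path_edges[of n m] path_edges_balance[where n = n and m = m] in auto)
  then show ?thesis by (simp add: h_series_def)
qed

lemma prod_X_path:
  "\<exists>M. (\<Prod>i\<in>{1..<n}. X i (i + 1)) = Poly_Mapping.single M 1 \<and>
    mset (edges_of M) = mset (map (\<lambda>i. ((i, Suc i), 0)) [1..<n])"
proof (induction n)
  case 0
  show ?case by (intro exI[of _ 0]) simp
next
  case (Suc n)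
  then obtain M where M: "(\<Prod>i\<in>{1..<n}. X i (i + 1)) = Poly_Mapping.single M 1"
    "mset (edges_of M) = mset (map (\<lambda>i. ((i, Suc i), 0)) [1..<n])" by blast
  show ?case
  proof (cases "n = 0")
    case True
    then show ?thesis by (intro exI[of _ 0]) simp
  next
    case False
    then show ?thesis using M
      by (intro exI[of _ "M + xmon n (Suc n)"])
        (simp add: prod.atLeastLessThan_Suc X_def mult_single mset_edges_of_add mset_edges_of_xmon)
  qed
qed

lemma power_X_path:
  "\<exists>M. (\<Prod>i\<in>{1..<n}. X i (i + 1)) ^ m = Poly_Mapping.single M 1 \<and>
    mset (edges_of M) = mset (path_edges n m)"
proof (induction m)
  case 0
  show ?case by (intro exI[of _ 0]) (simp add: path_edges_def)
next
  case (Suc m)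
  then obtain M where M: "(\<Prod>i\<in>{1..<n}. X i (i + 1)) ^ m = Poly_Mapping.single M 1"
    "mset (edges_of M) = mset (path_edges n m)" by blast
  obtain N where N: "(\<Prod>i\<in>{1..<n}. X i (i + 1)) = Poly_Mapping.single N 1"
    "mset (edges_of N) = mset (map (\<lambda>i. ((i, Suc i), 0)) [1..<n])" using prod_X_path by blast
  show ?case using M N
    by (intro exI[of _ "N + M"]) (simp add: mult_single mset_edges_of_add path_edges_def)
qed

lemma shift_beta_reduced_value_monom:
  assumes "acyclic_edges K es" "mset (edges_of M) = mset es"
  shows "shift_beta (reduced_value (Poly_Mapping.single M 1)) = h_series K es"
proof -
  have "valid_monom K M"
    using assms acyclic_edges_mset_cong acyclic_edges_of by blast
  then have "shift_beta (reduced_value (Poly_Mapping.single M 1)) = h_monom K M"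
    by (subst shift_beta_reduced_value[of K]) (simp_all add: valid_poly_def)
  then show ?thesis using h_series_mset_cong[OF assms(2)] by (simp add: h_monom_def)
qed

text \<open>Reciprocity matches coefficient \<open>i\<close> of \<open>h\<close> with coefficient
  \<open>length - i\<close> of the toggled series, which is \<open>t^m h\<close>; so it equals
  coefficient \<open>length - m - i\<close> of \<open>h\<close>.\<close>

lemma path_value_symmetric_nonneg:
  fixes n m :: nat
  defines "q \<equiv> pcompose (reduced_value ((\<Prod>i\<in>{1..<n}. X i (i + 1)) ^ m)) (beta - 1)"
  shows "symmetric_poly q \<and> (\<forall>i. 0 \<le> coeff q i)"
proof -
  let ?es = "path_edges n m"
  let ?h = "h_series (Suc n) ?es"
  obtain M where M: "(\<Prod>i\<in>{1..<n}. X i (i + 1)) ^ m = Poly_Mapping.single M 1"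
    "mset (edges_of M) = mset ?es" using power_X_path by blast
  have zero: "\<forall>(e, l)\<in>set ?es. l = 0" using set_path_edges[of n m] by auto
  have "beta - 1 = [:-1, 1:]" by (simp add: beta_def one_pCons)
  then have "fps_of_poly q = ?h"
    using shift_beta_reduced_value_monom[OF acyclic_path_edges M(2)]
    by (simp only: q_def M(1) shift_beta_def)
  then have q: "coeff q i = fps_nth ?h i" for i by (metis fps_of_poly_nth)
  have rec: "0 \<le> fps_nth ?h i \<and> fps_nth ?h i =
      (if i \<le> length ?es then fps_nth (h_series (Suc n) (toggle ?es)) (length ?es - i) else 0)" for i
  proof -
    have "\<forall>(e, l)\<in>set ?es. l \<le> 1" using zero by auto
    then show ?thesis using reciprocal_acyclic[OF acyclic_path_edges, of n m] unfolding reciprocal_def by blast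
  qed
  have one: "coeff q 0 = 1"
    unfolding q by (rule h_series_constant_coeff[OF acyclic_path_edges zero])
  have "symmetric_poly q"
  proof (cases "2 \<le> n")
    case True
    \<comment> \<open>This is the number \<open>m * (n - 1)\<close> of edges minus the shift
      \<open>m\<close>.\<close>
    define d where "d = m * (n - 2)"
    obtain n' where n': "n = n' + 2" using True by (metis add.commute le_Suc_ex)
    have len: "length ?es = d + m" by (simp add: length_path_edges d_def n' algebra_simps)
    have sym: "coeff q i = (if i \<le> d then coeff q (d - i) else 0)" for i
    proof -
      have "coeff q i = (if i \<le> d + m then fps_nth (fps_X ^ m * ?h) (d + m - i) else 0)"
        using rec[of i] h_series_toggle_path[OF True] by (simp only: q len)
      also have "\<dots> = (if i \<le> d then coeff q (d - i) else 0)"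
        by (auto simp: fps_X_power_mult_nth q)
      finally show ?thesis .
    qed
    have "degree q = d"
    proof (rule antisym)
      have "coeff q i = 0" if "d < i" for i using sym[of i] that by simp
      then show "degree q \<le> d" by (intro degree_le) blast
      \<comment> \<open>The reflection sends the constant coefficient 1 to position
        \<open>d\<close>.\<close>
      show "d \<le> degree q" by (rule le_degree) (use sym[of d] one in simp)
    qed
    then show ?thesis
      unfolding symmetric_poly_def
      by (intro allI impI) (simp only:, rule trans[OF sym if_P])
  next
    case False
    \<comment> \<open>For \<open>n < 2\<close> the product is empty and the polynomial is
      constant.\<close>
    then have "length ?es = 0" by (cases n) (auto simp: length_path_edges)
    then have "coeff q i = 0" if "i > 0" for i using rec[of i] that by (simp add: q)
    then have "degree q = 0" by (metis degree_le le_zero_eq)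
    then show ?thesis by (simp add: symmetric_poly_def)
  qed
  moreover have "0 \<le> coeff q i" for i unfolding q by (rule conjunct1[OF rec])
  ultimately show ?thesis by blast
qed

section \<open>Delannoy polynomials\<close>

text \<open>The recurrence by the first step of a path, with \<open>beta\<close> marking diagonal
  steps. It links reduced values, binomial sums and path counts.\<close>

fun delannoy_poly :: "nat \<Rightarrow> nat \<Rightarrow> int poly" where
  "delannoy_poly 0 m = 1"
| "delannoy_poly (Suc n) 0 = 1"
| "delannoy_poly (Suc n) (Suc m) =
     delannoy_poly (Suc n) m + delannoy_poly n (Suc m) + beta * delannoy_poly n m"

lemma delannoy_poly_0_right [simp]: "delannoy_poly n 0 = 1"
  by (cases n) auto

text \<open>
  The edges \<open>(1, 3)\<close> created on the way never take part in a replacement, so their number is irrelevant.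
\<close>

definition two_step_edges :: "nat \<Rightarrow> nat \<Rightarrow> nat \<Rightarrow> hedge list" where
  "two_step_edges c n m = replicate c ((1, 3), 0) @ replicate n ((1, 2), 0) @ replicate m ((2, 3), 0)"

lemma acyclic_two_step_edges: "acyclic_edges 4 (two_step_edges c n m)"
  by (auto simp: acyclic_edges_def two_step_edges_def)

text \<open>One exchange followed by lowering a bound is the recurrence of
  \<open>delannoy_poly\<close>. It increases the number \<open>c\<close> of edges
  \<open>(1, 3)\<close>, so \<open>c\<close> is kept arbitrary in the induction.\<close>

lemma h_series_two_step_edges: "h_series 4 (two_step_edges c n m) = shift_beta (delannoy_poly n m)"
proof (induction n m arbitrary: c rule: delannoy_poly.induct)
  have alt: "h_series 4 (two_step_edges c n m) = 1" if "n = 0 \<or> m = 0" for c n m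
  proof -
    have "h_series 4 (two_step_edges c n m) = fps_X ^ sum_list (map snd (two_step_edges c n m))"
      using that by (intro h_series_alternating acyclic_two_step_edges)
        (auto simp: alternating_def two_step_edges_def)
    also have "sum_list (map snd (two_step_edges c n m)) = 0" by (simp add: two_step_edges_def sum_list_replicate)
    finally show ?thesis by simp
  qed
  { case 1 show ?case by (simp add: alt) }
  { case 2 show ?case by (simp add: alt) }
  case (3 n m)
  let ?r = "two_step_edges c n m" and ?x = "((1, 2), 0)" and ?y = "\<lambda>l. ((2, 3), l)" and ?z = "((1, 3), 0)"
  have "h_series 4 (two_step_edges c (Suc n) (Suc m)) = h_series 4 (?x # ?y 0 # ?r)"
    by (rule h_series_mset_cong) (simp add: two_step_edges_def)
  also have "\<dots> = h_series 4 (?z # ?x # ?r) + h_series 4 (?z # ?y 1 # ?r)"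
    using h_series_exchange[of 1 2 3 4 ?r 0 0 0] by (simp add: acyclic_two_step_edges)
  also have "h_series 4 (?z # ?y 1 # ?r) = h_series 4 (?y 1 # ?z # ?r)"
    by (rule h_series_mset_cong) simp
  also have "\<dots> = h_series 4 (?y 0 # ?z # ?r) + (fps_X - 1) * h_series 4 (?z # ?r)"
    using h_series_split_bound[of 4 "(2, 3)" "?z # ?r"] by (simp add: acyclic_two_step_edges algebra_simps)
  also have "h_series 4 (?z # ?x # ?r) = h_series 4 (two_step_edges (Suc c) (Suc n) m)"
    by (rule h_series_mset_cong) (simp add: two_step_edges_def)
  also have "h_series 4 (?y 0 # ?z # ?r) = h_series 4 (two_step_edges (Suc c) n (Suc m))"
    by (rule h_series_mset_cong) (simp add: two_step_edges_def)
  also have "h_series 4 (?z # ?r) = h_series 4 (two_step_edges (Suc c) n m)"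
    by (rule h_series_mset_cong) (simp add: two_step_edges_def)
  finally show ?case
    by (simp only: 3 delannoy_poly.simps shift_beta_add shift_beta_mult shift_beta_beta) (simp add: algebra_simps)
qed

lemma X_power: "X i j ^ n = Poly_Mapping.single (Poly_Mapping.single (i, j) n) 1"
  by (induction n) (simp_all add: X_def xmon_def mult_single flip: single_add)

lemma mset_edges_of_single: "mset (edges_of (Poly_Mapping.single e n)) = mset (replicate n (e, 0))"
proof (rule multiset_eqI)
  fix x show "count (mset (edges_of (Poly_Mapping.single e n))) x = count (mset (replicate n (e, 0))) x"
    by (cases x) (auto simp: count_edges_of lookup_single when_def)
qed

lemma reduced_value_two_step: "reduced_value (X 1 2 ^ n * X 2 3 ^ m) = delannoy_poly n m"
proof (rule inj_shift_beta)
  let ?M = "Poly_Mapping.single (1, 2) n + Poly_Mapping.single (2, 3) m"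
  have "mset (edges_of ?M) = mset (two_step_edges 0 n m)"
    by (simp add: mset_edges_of_add mset_edges_of_single two_step_edges_def)
  moreover have "X 1 2 ^ n * X 2 3 ^ m = Poly_Mapping.single ?M 1"
    by (simp add: X_power mult_single)
  ultimately show "shift_beta (reduced_value (X 1 2 ^ n * X 2 3 ^ m)) = shift_beta (delannoy_poly n m)"
    using shift_beta_reduced_value_monom[OF acyclic_two_step_edges[of 0 n m]] h_series_two_step_edges
    by simp
qed

section \<open>Closed forms of the Delannoy polynomials\<close>

lemma beta_power: "beta ^ k = monom 1 k"
  by (simp add: beta_def monom_altdef)

text \<open>The recurrence follows from Pascal's rule, applied once to each of the two
  binomials.\<close>

lemma coeff_delannoy_poly: "coeff (delannoy_poly n m) k = int (((n + m - k) choose m) * (m choose k))"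
proof (induction n m arbitrary: k rule: delannoy_poly.induct)
  case (1 m)
  show ?case by (cases "k = 0"; cases "k \<le> m") auto
next
  case (2 n)
  show ?case by (cases k) auto
next
  case (3 n m)
  show ?case
  proof (cases k)
    case 0
    then show ?thesis by (simp add: 3 beta_def)
  next
    case (Suc j)
    \<comment> \<open>In the first range the three differences coincide without truncation; in the
      second every lower index in \<open>k\<close> or \<open>j\<close> is too large and all terms
      vanish.\<close>
    consider "k \<le> n + m + 1" | "k > n + m + 1" by linarith
    then show ?thesis
    proof cases
      case 1
      then have "Suc n + Suc m - k = Suc (Suc n + m - k)" "n + Suc m - k = Suc n + m - k" "n + m - j = Suc n + m - k"
        using Suc by auto
      then show ?thesis using Suc
        by (simp only: delannoy_poly.simps coeff_add 3 beta_def coeff_pCons_Suc mult_pCons_left) (simp add: 3 algebra_simps)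
    next
      case 2
      then show ?thesis using Suc by (simp add: 3 beta_def binomial_eq_0)
    qed
  qed
qed

lemma delannoy_poly_eq_sum:
  "delannoy_poly n m = (\<Sum>k=0..min n m. of_nat ((n + m - k) choose m) * of_nat (m choose k) * beta ^ k)"
proof (rule poly_eqI)
  fix j
  have "coeff (of_nat a * of_nat b * beta ^ k) j = (if k = j then int (a * b) else 0)" for a b k
    by (simp add: beta_power of_nat_poly smult_monom flip: of_nat_mult)
  then have "coeff (\<Sum>k=0..min n m. of_nat ((n + m - k) choose m) * of_nat (m choose k) * beta ^ k) j =
      (if j \<le> min n m then int (((n + m - j) choose m) * (m choose j)) else 0)"
    by (simp add: coeff_sum)
  \<comment> \<open>Beyond the summation range the product vanishes: the second factor if
    \<open>j > m\<close>, and the first if \<open>n < j \<le> m\<close>, since then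
    \<open>n + m - j < m\<close>.\<close>
  also have "\<dots> = int (((n + m - j) choose m) * (m choose j))"
    by (auto simp: binomial_eq_0)
  finally show "coeff (delannoy_poly n m) j =
      coeff (\<Sum>k=0..min n m. of_nat ((n + m - k) choose m) * of_nat (m choose k) * beta ^ k) j"
    by (simp add: coeff_delannoy_poly)
qed

text \<open>With \<open>a, a'\<close> the binomials of \<open>n\<close> over \<open>k\<close> and
  \<open>k - 1\<close>, and \<open>b, b'\<close> those of \<open>m\<close>, the recurrence in powers
  of \<open>t\<close> is
  \<open>(a + a')(b + b') = (a + a')b + a(b + b') + a'b' - ab\<close>.\<close>

lemma shift_beta_delannoy_poly_nth: "fps_nth (shift_beta (delannoy_poly n m)) k = int ((n choose k) * (m choose k))"
proof (induction n m arbitrary: k rule: delannoy_poly.induct)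
  case (1 m)
  show ?case by (cases k) auto
next
  case (2 n)
  show ?case by (cases k) auto
next
  case (3 n m)
  show ?case
    by (cases k) (simp_all add: shift_beta_add shift_beta_mult shift_beta_beta 3 left_diff_distrib algebra_simps)
qed

lemma shift_beta_of_nat [simp]: "shift_beta (of_nat a) = of_nat a"
  by (induction a) (simp_all add: shift_beta_add)

lemma shift_beta_power: "shift_beta (p ^ k) = shift_beta p ^ k"
  by (induction k) (simp_all add: shift_beta_mult)

lemma delannoy_poly_eq_sum_shifted:
  "delannoy_poly n m = (\<Sum>k=0..min n m. of_nat (n choose k) * of_nat (m choose k) * (1 + beta) ^ k)"
proof (rule inj_shift_beta, rule fps_ext)
  fix j
  have "shift_beta (1 + beta) = fps_X" by (simp add: shift_beta_add shift_beta_beta)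
  then have "shift_beta (of_nat a * of_nat b * (1 + beta) ^ k) = of_nat (a * b) * fps_X ^ k" for a b k
    by (simp add: shift_beta_mult shift_beta_power)
  then have "fps_nth (shift_beta (of_nat a * of_nat b * (1 + beta) ^ k)) j = (if k = j then int (a * b) else 0)" for a b k
    by (simp add: fps_of_nat fps_X_power_nth del: of_nat_mult)
  then have "fps_nth (shift_beta (\<Sum>k=0..min n m. of_nat (n choose k) * of_nat (m choose k) * (1 + beta) ^ k)) j =
      (if j \<le> min n m then int ((n choose j) * (m choose j)) else 0)"
    by (simp add: shift_beta_sum fps_sum_nth)
  also have "\<dots> = int ((n choose j) * (m choose j))"
    by (auto simp: binomial_eq_0)
  finally show "fps_nth (shift_beta (delannoy_poly n m)) j =
      fps_nth (shift_beta (\<Sum>k=0..min n m. of_nat (n choose k) * of_nat (m choose k) * (1 + beta) ^ k)) j"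
    by (simp add: shift_beta_delannoy_poly_nth)
qed

section \<open>Delannoy paths\<close>

lemma walk_eq: "walk (a, b) w = (a + fst (walk (0, 0) w), b + snd (walk (0, 0) w))"
proof (induction w arbitrary: a b)
  case (Cons s w)
  show ?case
    by (cases s) (simp_all add: Cons[of "Suc a" b] Cons[of a "Suc b"] Cons[of "Suc a" "Suc b"]
        Cons[of "Suc 0" 0] Cons[of 0 "Suc 0"] Cons[of "Suc 0" "Suc 0"])
qed simp

lemma Nil_in_delannoy_paths: "[] \<in> delannoy_paths n m \<longleftrightarrow> n = 0 \<and> m = 0"
  by (auto simp: delannoy_paths_def)

lemma Cons_in_delannoy_paths:
  "East # w \<in> delannoy_paths n m \<longleftrightarrow> (\<exists>n'. n = Suc n' \<and> w \<in> delannoy_paths n' m)"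
  "North # w \<in> delannoy_paths n m \<longleftrightarrow> (\<exists>m'. m = Suc m' \<and> w \<in> delannoy_paths n m')"
  "NorthEast # w \<in> delannoy_paths n m \<longleftrightarrow> (\<exists>n' m'. n = Suc n' \<and> m = Suc m' \<and> w \<in> delannoy_paths n' m')"
  by (auto simp: delannoy_paths_def walk_eq[of "Suc 0"] walk_eq[of 0 "Suc 0"] prod_eq_iff)

lemma delannoy_paths_0: "delannoy_paths 0 m = {replicate m North}" "delannoy_paths n 0 = {replicate n East}"
proof -
  have "w \<in> delannoy_paths 0 m \<longleftrightarrow> w = replicate m North" for w
  proof (induction w arbitrary: m)
    case (Cons s w)
    then show ?case by (cases s; cases m) (auto simp: Cons_in_delannoy_paths)
  qed (auto simp: Nil_in_delannoy_paths)
  then show "delannoy_paths 0 m = {replicate m North}" by auto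
  have "w \<in> delannoy_paths n 0 \<longleftrightarrow> w = replicate n East" for w
  proof (induction w arbitrary: n)
    case (Cons s w)
    then show ?case by (cases s; cases n) (auto simp: Cons_in_delannoy_paths)
  qed (auto simp: Nil_in_delannoy_paths)
  then show "delannoy_paths n 0 = {replicate n East}" by auto
qed

lemma delannoy_paths_Suc:
  "delannoy_paths (Suc n) (Suc m) = (#) North ` delannoy_paths (Suc n) m \<union>
     (#) East ` delannoy_paths n (Suc m) \<union> (#) NorthEast ` delannoy_paths n m"
proof (rule set_eqI)
  fix w show "w \<in> delannoy_paths (Suc n) (Suc m) \<longleftrightarrow> w \<in> (#) North ` delannoy_paths (Suc n) m \<union>
     (#) East ` delannoy_paths n (Suc m) \<union> (#) NorthEast ` delannoy_paths n m"
  proof (cases w)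
    case (Cons s v)
    then show ?thesis by (cases s) (auto simp: Cons_in_delannoy_paths)
  qed (auto simp: Nil_in_delannoy_paths)
qed

lemma finite_delannoy_paths: "finite (delannoy_paths n m)"
  by (induction n m rule: delannoy_poly.induct) (simp_all add: delannoy_paths_0 delannoy_paths_Suc)

lemma card_delannoy_paths:
  "int (card {w \<in> delannoy_paths n m. count_list w NorthEast = k}) = coeff (delannoy_poly n m) k"
proof (induction n m arbitrary: k rule: delannoy_poly.induct)
  have "count_list (replicate n s) NorthEast = 0" if "s \<noteq> NorthEast" for n s
    using that by (induction n) auto
  then have base: "{w. w = replicate n s \<and> count_list w NorthEast = k} = (if k = 0 then {replicate n s} else {})"
    if "s \<noteq> NorthEast" for n s k using that by auto
  { case (1 m) show ?case by (simp add: delannoy_paths_0 base) }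
  { case (2 n) show ?case by (simp add: delannoy_paths_0 base del: replicate.simps) }
  case (3 n m)
  let ?W = "\<lambda>n m k. {w \<in> delannoy_paths n m. count_list w NorthEast = k}"
  \<comment> \<open>A diagonal first step uses up one of the \<open>k\<close>; the case
    \<open>k = 0\<close> is separate because \<open>k - 1\<close> truncates to 0.\<close>
  let ?D = "if k = 0 then {} else ?W n m (k - 1)"
  have fin: "finite (?W n m k)" for n m k using finite_delannoy_paths by simp
  have W: "?W (Suc n) (Suc m) k = (#) North ` ?W (Suc n) m k \<union> (#) East ` ?W n (Suc m) k \<union> (#) NorthEast ` ?D"
    by (cases k) (auto simp: delannoy_paths_Suc image_iff)
  have "card (?W (Suc n) (Suc m) k) = card (?W (Suc n) m k) + card (?W n (Suc m) k) + card ?D"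
    unfolding W using fin by (subst card_Un_disjoint, simp, simp, blast)+ (simp add: card_image)
  then show ?case
    by (cases k) (simp_all add: 3 beta_def)
qed

theorem lemma5p3:
  fixes n m :: nat
  shows "reduced_value (X 1 2 ^ n * X 2 3 ^ m) =
           (\<Sum>k=0..min n m. of_nat ((n + m - k) choose m) * of_nat (m choose k) * beta ^ k) \<and>
         reduced_value (X 1 2 ^ n * X 2 3 ^ m) =
           (\<Sum>k=0..min n m. of_nat (n choose k) * of_nat (m choose k) * (1 + beta) ^ k) \<and>
         symmetric_poly (pcompose (reduced_value ((\<Prod>i\<in>{1..<n}. X i (i + 1)) ^ m)) (beta - 1)) \<and>
         (\<forall>i. 0 \<le> coeff (pcompose (reduced_value ((\<Prod>i\<in>{1..<n}. X i (i + 1)) ^ m)) (beta - 1)) i) \<and>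
         (\<forall>k. coeff (reduced_value (X 1 2 ^ n * X 2 3 ^ m)) k =
           int (card {w \<in> delannoy_paths n m. count_list w NorthEast = k}))"
  using delannoy_poly_eq_sum delannoy_poly_eq_sum_shifted path_value_symmetric_nonneg
  unfolding reduced_value_two_step card_delannoy_paths by simp

end
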